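(* Let $k\ge 1$ be an integer, let $T$ be an antidirected tree with $k$ arcs, and let $D$ be a digraph with $\bar\delta^0(D)\ge k/2$ such that every $4$-cycle of $D$ (i.e. every subgraph of $D$ that is an orientation of a cycle on $4$ distinct vertices) is a directed cycle. If $\Delta^\pm(D)>\Delta^{tot}(T)$, then $D$ contains $T$ as a subgraph.
   Context: Digraphs are finite, without loops or parallel arcs (directed $2$-cycles are allowed). A digraph is antidirected if each vertex has indegree $0$ or outdegree $0$; an antidirected tree is an orientation of a tree with this property. The minimum pseudo-semidegree $\bar\delta^0(D)$ is $0$ if $D$ has no arcs, and otherwise is the largest integer $d$ such that no vertex of $D$ has positive indegree less than $d$ or positive outdegree less than $d$. $\Delta^{tot}(T)$ is the maximum degree of the underlying undirected graph of $T$. $\Delta^\pm(D)$ is the largest integer $m$ such that $D$ has a vertex of outdegree at least $m$ and a vertex of indegree at least $m$ (possibly the same vertex). $D$ contains $T$ means there is an injective map $V(T)\to V(D)$ sending each arc of $T$ to an arc of $D$ with the same direction. *)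

theory Defs
  imports Complex_Main "Graph_Theory.Digraph_Component"
begin

text \<open>
  Finite digraphs without loops or parallel arcs are the structures satisfying the locale
  predicate \<open>pair_digraph\<close>; opposite arcs \<open>(u, v)\<close> and \<open>(v, u)\<close> may both be present.
  \<open>mk_symmetric G\<close> plays the role of the underlying undirected graph of \<open>G\<close>.
\<close>

text \<open>
  The library predicate \<open>tree\<close> only forbids directed cycles, so it is not the notion needed
  here. A cycle of the underlying graph is a cycle of \<open>mk_symmetric G\<close> of length at least 3
  (length 2 is going back and forth along an edge). Antisymmetry says that every edge of the
  underlying graph is oriented in exactly one direction. The qualified \<open>connected\<close> is
  connectedness of the underlying graph and includes nonemptiness.
\<close>
definition oriented_tree :: "'a pair_pre_digraph \<Rightarrow> bool" where
  "oriented_tree G \<longleftrightarrow>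
     pair_digraph G \<and>
     (\<forall>u v. (u, v) \<in> parcs G \<longrightarrow> (v, u) \<notin> parcs G) \<and>
     Digraph_Component.connected (with_proj G) \<and>
     \<not> (\<exists>p. 3 \<le> length p \<and>
           pre_digraph.cycle (with_proj (mk_symmetric (with_proj G))) p)"

definition antidirected :: "'a pair_pre_digraph \<Rightarrow> bool" where
  "antidirected G \<longleftrightarrow>
     (\<forall>v \<in> pverts G. in_degree (with_proj G) v = 0 \<or> out_degree (with_proj G) v = 0)"

definition antidirected_tree :: "'a pair_pre_digraph \<Rightarrow> bool" where
  "antidirected_tree G \<longleftrightarrow> oriented_tree G \<and> antidirected G"

definition min_pseudo_semidegree :: "'a pair_pre_digraph \<Rightarrow> nat" where
  "min_pseudo_semidegree G =
     (if parcs G = {} then 0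
      else GREATEST d. \<not> (\<exists>v \<in> pverts G.
             (0 < in_degree (with_proj G) v \<and> in_degree (with_proj G) v < d) \<or>
             (0 < out_degree (with_proj G) v \<and> out_degree (with_proj G) v < d)))"

text \<open>
  In \<open>mk_symmetric G\<close> the out-degree of \<open>v\<close> is the number of neighbours of \<open>v\<close> in the
  underlying undirected graph. Meaningful for nonempty vertex sets only.
\<close>
definition max_total_degree :: "'a pair_pre_digraph \<Rightarrow> nat" where
  "max_total_degree G =
     Max ((\<lambda>v. out_degree (with_proj (mk_symmetric (with_proj G))) v) ` pverts G)"

text \<open>Meaningful for nonempty vertex sets only.\<close>
definition max_semidegree :: "'a pair_pre_digraph \<Rightarrow> nat" where
  "max_semidegree G =
     (GREATEST m. (\<exists>u \<in> pverts G. m \<le> out_degree (with_proj G) u) \<and>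
                  (\<exists>v \<in> pverts G. m \<le> in_degree (with_proj G) v))"

definition oriented_4cycle :: "'a pair_pre_digraph \<Rightarrow> bool" where
  "oriented_4cycle C \<longleftrightarrow>
     (\<exists>a b c d e1 e2 e3 e4. distinct [a, b, c, d] \<and>
        e1 \<in> {(a, b), (b, a)} \<and> e2 \<in> {(b, c), (c, b)} \<and>
        e3 \<in> {(c, d), (d, c)} \<and> e4 \<in> {(d, a), (a, d)} \<and>
        C = \<lparr> pverts = {a, b, c, d}, parcs = {e1, e2, e3, e4} \<rparr>)"

definition directed_4cycle :: "'a pair_pre_digraph \<Rightarrow> bool" where
  "directed_4cycle C \<longleftrightarrow>
     (\<exists>a b c d. distinct [a, b, c, d] \<and>
        C = \<lparr> pverts = {a, b, c, d}, parcs = {(a, b), (b, c), (c, d), (d, a)} \<rparr>)"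

definition contains_digraph :: "'a pair_pre_digraph \<Rightarrow> 'b pair_pre_digraph \<Rightarrow> bool" where
  "contains_digraph G H \<longleftrightarrow>
     (\<exists>f. inj_on f (pverts H) \<and> f ` pverts H \<subseteq> pverts G \<and>
          (\<forall>u v. (u, v) \<in> parcs H \<longrightarrow> (f u, f v) \<in> parcs G))"

end

theory Submission
  imports Defs
begin

text \<open>
  Sources of \<open>T\<close> must go to tails and sinks to heads of arcs of \<open>D\<close>, so an embedding only sees the
  sets \<open>N s v\<close> of out-neighbours (\<open>s = True\<close>) and in-neighbours (\<open>s = False\<close>). The hypothesis on
  4-cycles says that two elements of one \<open>N s u\<close> have no further common neighbour of any kind.

  Stars, double stars and the path with four arcs are embedded directly, starting at a vertex of
  large semidegree. Any other tree has penultimate vertices \<open>x\<close>, \<open>t\<close> (all neighbours but one are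
  leaves) such that \<open>t\<close> is not the inner neighbour \<open>p\<close> of \<open>x\<close> and has at least as many leaves as
  \<open>x\<close>. By induction \<open>T\<close> minus a leaf of \<open>x\<close> embeds in \<open>D\<close>; if this does not extend, then all
  at least \<open>k/2\<close> neighbours of the image of \<open>x\<close> are occupied. The image of \<open>p\<close> is saturated in the
  same sense: otherwise \<open>x\<close> has a second possible position at a free neighbour of it, and the
  neighbourhoods of the two positions leave so few vertices uncovered that both contain a leaf of
  \<open>t\<close>, and relocating these leaves makes room. As the neighbourhoods of \<open>x\<close> and \<open>p\<close> share at most one vertex, they then cover
  all occupied vertices but one, and the 4-cycle condition restricts \<open>T\<close> to the path with four arcs.
\<close>

section \<open>Embeddings into digraphs whose 4-cycles are directed\<close>

text \<open>\<open>E\<close> will be the symmetric edge relation of the tree, and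
  \<open>\<sigma> u\<close> tells whether \<open>u\<close> is a source; one bit per vertex suffices
  for antidirected trees. Partial embeddings are those with a smaller \<open>W\<close>.\<close>

definition emb :: "(bool \<Rightarrow> 'a \<Rightarrow> 'a set) \<Rightarrow> ('b \<Rightarrow> bool) \<Rightarrow> ('b \<times> 'b) set \<Rightarrow> ('b \<Rightarrow> 'a) \<Rightarrow> 'b set \<Rightarrow> bool" where
  "emb N \<sigma> E f W \<longleftrightarrow>
     inj_on f W \<and> (\<forall>u\<in>W. \<forall>v\<in>W. (u, v) \<in> E \<longrightarrow> f v \<in> N (\<sigma> u) (f u))"

definition leaf_at :: "('b \<times> 'b) set \<Rightarrow> 'b \<Rightarrow> 'b \<Rightarrow> bool" where
  "leaf_at E x y \<longleftrightarrow> (x, y) \<in> E \<and> (\<forall>z. (y, z) \<in> E \<longrightarrow> z = x)"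

definition penultimate :: "('b \<times> 'b) set \<Rightarrow> 'b \<Rightarrow> 'b \<Rightarrow> bool" where
  "penultimate E x p \<longleftrightarrow>
     (x, p) \<in> E \<and> (\<exists>y. y \<noteq> p \<and> (x, y) \<in> E) \<and> (\<forall>y. (x, y) \<in> E \<longrightarrow> y \<noteq> p \<longrightarrow> leaf_at E x y)"

text \<open>Connectivity is only used to find an edge leaving a given set of vertices, hence the
  form with cuts instead of walks.\<close>

definition cut_connected :: "'b set \<Rightarrow> ('b \<times> 'b) set \<Rightarrow> bool" where
  "cut_connected V E \<longleftrightarrow>
     (\<forall>W. W \<subseteq> V \<longrightarrow> W \<noteq> {} \<longrightarrow> W \<noteq> V \<longrightarrow> (\<exists>u\<in>W. \<exists>v\<in>V - W. (u, v) \<in> E))"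

lemma cut_connectedE:
  assumes "cut_connected V E" "W \<subseteq> V" "W \<noteq> {}" "W \<noteq> V"
  obtains u v where "u \<in> W" "v \<in> V" "v \<notin> W" "(u, v) \<in> E"
  using assms unfolding cut_connected_def by blast

text \<open>The set \<open>R\<close> is attached to the rest through \<open>p\<close> alone. A cut
  containing \<open>p\<close> is enlarged by \<open>R\<close>, and no edge leaves the enlarged cut
  from \<open>R\<close>; an edge leaving a cut without \<open>p\<close> cannot end in
  \<open>R\<close>.\<close>

lemma cut_connected_Diff:
  assumes conn: "cut_connected V E" and sym: "\<And>u v. (u, v) \<in> E \<Longrightarrow> (v, u) \<in> E"
    and p: "p \<in> V" "p \<notin> R" and R: "R \<subseteq> V"
    and out: "\<And>u v. u \<in> R \<Longrightarrow> (u, v) \<in> E \<Longrightarrow> v \<in> insert p R"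
  shows "cut_connected (V - R) E"
  unfolding cut_connected_def
proof (intro allI impI)
  fix W assume W: "W \<subseteq> V - R" "W \<noteq> {}" "W \<noteq> V - R"
  show "\<exists>u\<in>W. \<exists>v\<in>V - R - W. (u, v) \<in> E"
  proof (cases "p \<in> W")
    case True
    have "W \<union> R \<subseteq> V" "W \<union> R \<noteq> {}" "W \<union> R \<noteq> V" using W R by auto
    then obtain u v where "u \<in> W \<union> R" "v \<in> V" "v \<notin> W \<union> R" "(u, v) \<in> E"
      using conn by (blast elim: cut_connectedE)
    then show ?thesis using out True by blast
  next
    case False
    have "W \<subseteq> V" "W \<noteq> V" using W R p by auto
    then obtain u v where "u \<in> W" "v \<in> V" "v \<notin> W" "(u, v) \<in> E"
      using conn W(2) by (blast elim: cut_connectedE)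
    then show ?thesis using out sym False W(1) by blast
  qed
qed

text \<open>In \<open>no_4cycle\<close> the arcs joining \<open>u\<close> to \<open>v\<close> and
  \<open>v'\<close> both leave or both enter \<open>u\<close>, so the 4-cycle \<open>u\<close>,
  \<open>v\<close>, \<open>w\<close>, \<open>v'\<close> is not directed, whatever the directions
  \<open>s1\<close>, \<open>s2\<close> at \<open>w\<close>.\<close>

locale c4_host =
  fixes N :: "bool \<Rightarrow> 'a \<Rightarrow> 'a set"
  assumes N_sym: "w \<in> N s v \<longleftrightarrow> v \<in> N (\<not> s) w"
    and N_irrefl: "v \<notin> N s v"
    and N_finite: "finite (N s v)"
    and no_4cycle: "\<lbrakk>v \<in> N s u; v' \<in> N s u; v \<noteq> v'; w \<noteq> u; w \<in> N s1 v; w \<in> N s2 v'\<rbrakk> \<Longrightarrow> False"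
begin

lemma common_nbr_unique:
  assumes "u \<noteq> u'" "v \<in> N s u" "v \<in> N s' u'" "v' \<in> N s u" "v' \<in> N s' u'"
  shows "v = v'"
  using no_4cycle[OF assms(2,4), of u' "\<not> s'" "\<not> s'"] assms N_sym by metis

lemma card_Int_N_le:
  assumes "u \<noteq> u'"
  shows "card (N s u \<inter> N s' u') \<le> 1"
proof -
  have "\<forall>v\<in>N s u \<inter> N s' u'. \<forall>v'\<in>N s u \<inter> N s' u'. v = v'"
    using common_nbr_unique[OF assms] by blast
  then show ?thesis
    using N_finite by (simp add: card_le_Suc0_iff_eq)
qed

text \<open>Since \<open>f\<close> is only an embedding away from \<open>y\<close>, this serves both
  to place a new leaf and to move a leaf that already has a position.\<close>

lemma emb_extend_leaf:
  assumes f: "emb N \<sigma> E f (W - {y})"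
    and y: "\<And>z'. (y, z') \<in> E \<Longrightarrow> z' = z" "\<And>z'. (z', y) \<in> E \<Longrightarrow> z' = z"
    and zy: "\<sigma> z \<noteq> \<sigma> y" "z \<noteq> y"
    and u: "u \<in> N (\<sigma> z) (f z)" "u \<notin> f ` (W - {y})"
  shows "emb N \<sigma> E (f(y := u)) W"
proof -
  have "inj_on (f(y := u)) W"
    using f u(2) unfolding emb_def inj_on_def by auto
  moreover have "(f(y := u)) b \<in> N (\<sigma> a) ((f(y := u)) a)"
    if "a \<in> W" "b \<in> W" "(a, b) \<in> E" for a b
  proof (cases "b = y")
    case True
    then show ?thesis using y(2)[of a] that zy u by auto
  next
    case False
    show ?thesis
    proof (cases "a = y")
      case True
      then have "b = z" using y(1) that by blast
      moreover have "f z \<in> N (\<sigma> y) u" using u(1) N_sym[of u "\<sigma> z" "f z"] zy by simp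
      ultimately show ?thesis using True False by simp
    next
      case False
      then show ?thesis using f that \<open>b \<noteq> y\<close> unfolding emb_def by simp
    qed
  qed
  ultimately show ?thesis unfolding emb_def by blast
qed

text \<open>For rebuilding the star at \<open>x\<close> in a new position \<open>w\<close>. Edges
  ending in \<open>insert x W\<close> are checked first; those ending in \<open>L\<close> follow by
  symmetry.\<close>

lemma emb_extend_star:
  assumes f: "emb N \<sigma> E f W" and W: "x \<notin> W" "W \<inter> L = {}" "x \<notin> L" "p \<in> W"
    and sym: "\<And>u v. (u, v) \<in> E \<Longrightarrow> (v, u) \<in> E"
    and \<sigma>: "\<And>u v. (u, v) \<in> E \<Longrightarrow> \<sigma> u \<noteq> \<sigma> v"
    and x: "\<And>v. (x, v) \<in> E \<Longrightarrow> v \<in> insert p L" "(x, p) \<in> E"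
    and L: "finite L" "\<And>l. l \<in> L \<Longrightarrow> leaf_at E x l"
    and w: "w \<in> N (\<sigma> p) (f p)" "w \<notin> f ` W"
    and M: "M \<subseteq> N (\<sigma> x) w" "M \<inter> f ` W = {}" "card L \<le> card M"
  shows "\<exists>g. emb N \<sigma> E g (W \<union> {x} \<union> L)"
proof -
  have finM: "finite M" using M(1) N_finite finite_subset by blast
  obtain h where h: "inj_on h L" "h ` L \<subseteq> M"
    using card_le_inj[OF L(1) finM M(3)] by auto
  define g where "g v = (if v \<in> W then f v else if v = x then w else h v)" for v
  have gW: "g v = f v" if "v \<in> W" for v using that by (simp add: g_def)
  have gx: "g x = w" using W by (simp add: g_def)
  have gL: "g v = h v" if "v \<in> L" for v using that W by (auto simp: g_def)
  have "w \<notin> M" using M(1) N_irrefl by blast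
  have "inj_on g (W \<union> {x} \<union> L)"
  proof -
    have "inj_on g W" using f gW unfolding emb_def inj_on_def by auto
    moreover have "inj_on g L" using h gL unfolding inj_on_def by auto
    moreover have img: "g ` W = f ` W" "g ` L = h ` L"
      using gW gL by (auto intro: image_cong)
    then have "g ` W \<inter> g ` L = {}" using h(2) M(2) by blast
    moreover have "g x \<notin> g ` W" "g x \<notin> g ` L"
      unfolding img using gx h(2) w(2) \<open>w \<notin> M\<close> by auto
    ultimately show ?thesis using W by (auto simp: inj_on_Un)
  qed
  moreover have edge: "g v \<in> N (\<sigma> u) (g u)"
    if uv: "(u, v) \<in> E" "v \<in> insert x W" "u \<in> W \<union> {x} \<union> L" for u v
  proof (cases "v = x")
    case False
    then have v: "v \<in> W" using uv by auto
    have "u \<notin> L" using L(2)[of u] uv(1) False unfolding leaf_at_def by blast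
    show ?thesis
    proof (cases "u = x")
      case True
      then have "v = p" using x(1) uv v W by blast
      then show ?thesis using w(1) N_sym[of w "\<sigma> p" "f p"] True gx gW[OF W(4)] \<sigma>[OF uv(1)] by simp
    next
      case False
      then show ?thesis using f uv \<open>u \<notin> L\<close> v gW unfolding emb_def by auto
    qed
  next
    case True
    have ux: "u \<in> insert p L" using uv x(1) sym True by blast
    have sux: "\<sigma> u \<noteq> \<sigma> x" using \<sigma>[OF uv(1)] True by simp
    show ?thesis
    proof (cases "u \<in> L")
      case True
      then have "h u \<in> N (\<sigma> x) w" using h M by auto
      then show ?thesis using N_sym[of "h u" "\<sigma> x" w] sux \<open>v = x\<close> gx gL[OF True] by simp
    next
      case False
      then show ?thesis using ux w(1) gW[OF W(4)] gx \<open>v = x\<close> by simp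
    qed
  qed
  moreover have "g v \<in> N (\<sigma> u) (g u)"
    if uv: "(u, v) \<in> E" "v \<in> W \<union> {x} \<union> L" "u \<in> W \<union> {x} \<union> L" for u v
  proof (cases "v \<in> insert x W")
    case True
    then show ?thesis using edge uv by blast
  next
    case False
    then have "v \<in> L" using uv by auto
    then have "u = x" using L(2) sym uv(1) unfolding leaf_at_def by blast
    then have "g u \<in> N (\<sigma> v) (g v)" using edge[of v u] sym uv by auto
    then show ?thesis using N_sym[of "g u" "\<sigma> v" "g v"] \<sigma>[OF uv(1)] by simp
  qed
  ultimately show ?thesis unfolding emb_def by blast
qed

end

section \<open>Near-embeddings that do not extend\<close>

text \<open>A failed induction step: all of the tree but the leaf \<open>y0\<close> of
  \<open>x\<close> is placed, and the tree does not embed. With \<open>card V = k + 1\<close>,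
  \<open>host_deg\<close> is the degree bound \<open>k/2\<close>. Moving leaves from
  \<open>Lt\<close> will make room for those of \<open>x\<close>.\<close>

locale near_embedding = c4_host N
  for N :: "bool \<Rightarrow> 'a \<Rightarrow> 'a set" +
  fixes V :: "'b set" and E :: "('b \<times> 'b) set" and \<sigma> :: "'b \<Rightarrow> bool" and f :: "'b \<Rightarrow> 'a"
    and x p y0 t :: 'b and Lt :: "'b set"
  assumes finV: "finite V" and EV: "E \<subseteq> V \<times> V"
    and E_sym: "(u, v) \<in> E \<Longrightarrow> (v, u) \<in> E"
    and \<sigma>: "(u, v) \<in> E \<Longrightarrow> \<sigma> u \<noteq> \<sigma> v"
    and conn: "cut_connected V E"
    and pen: "penultimate E x p" and xy0: "(x, y0) \<in> E" and y0p: "y0 \<noteq> p"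
    and t: "t \<in> V" "t \<noteq> x" "t \<noteq> p"
    and Lt: "l \<in> Lt \<Longrightarrow> leaf_at E t l"
    and card_leaves: "card (E `` {x} - {p}) \<le> card Lt"
    and emb_f: "emb N \<sigma> E f (V - {y0})"
    and not_emb: "\<not> emb N \<sigma> E g V"
    and host_deg: "N s w \<noteq> {} \<Longrightarrow> card V \<le> 2 * card (N s w) + 1"
begin

text \<open>\<open>V1\<close> holds the placed vertices; \<open>V2\<close> is what stays when the
  whole star at \<open>x\<close> is taken up.\<close>

definition "L = E `` {x} - {p}"
definition "V1 = V - {y0}"
definition "V2 = V - insert x L"
text \<open>The host neighbourhood of \<open>f u\<close> pulled back to the tree, so that all
  counting is done with tree vertices. Its elements need not be neighbours of \<open>u\<close> in
  the tree.\<close>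

definition "S u = {v \<in> V1. f v \<in> N (\<sigma> u) (f u)}"

lemma irrefl: "(u, v) \<in> E \<Longrightarrow> u \<noteq> v"
  using \<sigma> by blast

lemma in_V: "(u, v) \<in> E \<Longrightarrow> u \<in> V" "(u, v) \<in> E \<Longrightarrow> v \<in> V"
  using EV by auto

lemma xp: "(x, p) \<in> E" and L_leaf: "l \<in> L \<Longrightarrow> leaf_at E x l"
  using pen unfolding penultimate_def L_def by auto

lemma y0_L: "y0 \<in> L"
  using xy0 y0p by (simp add: L_def)

lemma y0_leaf: "(y0, z) \<in> E \<Longrightarrow> z = x"
  using L_leaf[OF y0_L] by (simp add: leaf_at_def)

lemma fin: "finite V1" "finite V2" "finite L" "finite (S u)" "finite Lt"
proof -
  show "finite V1" "finite V2" using finV by (auto simp: V1_def V2_def)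
  have "L \<subseteq> V" using in_V by (auto simp: L_def)
  then show "finite L" using finV finite_subset by blast
  show "finite (S u)" using \<open>finite V1\<close> by (auto simp: S_def)
  have "Lt \<subseteq> V" using Lt in_V unfolding leaf_at_def by blast
  then show "finite Lt" using finV finite_subset by blast
qed

lemma card_L: "card L \<le> card Lt" "1 \<le> card L"
  using card_leaves y0_L fin by (auto simp: L_def[symmetric] Suc_le_eq card_gt_0_iff)

lemma Lt_nonempty: "Lt \<noteq> {}"
  using card_L by auto

lemma x_notin: "x \<notin> L" "p \<notin> L" "x \<noteq> p" "x \<noteq> y0"
  using irrefl xp xy0 by (auto simp: L_def)

lemma p_not_leaf: "leaf_at E z p \<Longrightarrow> z = x"
  using xp E_sym by (auto simp: leaf_at_def)

lemma Lt_V2: "Lt \<subseteq> V2"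
proof
  fix l assume "l \<in> Lt"
  then have l: "leaf_at E t l" by (rule Lt)
  then have "l \<in> V" "(l, t) \<in> E" using in_V E_sym by (auto simp: leaf_at_def)
  moreover have "l \<noteq> x" using l xp t by (auto simp: leaf_at_def)
  moreover have "l \<notin> L" using L_leaf \<open>(l, t) \<in> E\<close> t by (auto simp: leaf_at_def)
  ultimately show "l \<in> V2" by (simp add: V2_def)
qed

lemma p_V2: "p \<in> V2"
  using in_V xp x_notin by (simp add: V2_def)

lemma t_V2: "t \<in> V2"
proof -
  obtain l where "l \<in> Lt" using Lt_nonempty by blast
  then have l: "leaf_at E t l" by (rule Lt)
  have "t \<notin> L"
  proof
    assume "t \<in> L"
    then have "l = x" using L_leaf l by (auto simp: leaf_at_def)
    then show False using l xp t by (auto simp: leaf_at_def)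
  qed
  then show ?thesis using t by (simp add: V2_def)
qed

lemma p_Lt: "p \<notin> Lt"
  using p_not_leaf Lt t by blast

lemma V1_eq: "V1 = V2 \<union> insert x (L - {y0})"
  using in_V xp y0_L x_notin by (auto simp: V1_def V2_def L_def)

lemma V2_V1: "V2 \<subseteq> V1" and x_V1: "x \<in> V1" and p_V1: "p \<in> V1" and t_V1: "t \<in> V1"
  using V1_eq p_V2 t_V2 by auto

lemma card_V1: "card V1 = card V2 + card L"
proof -
  have "card (insert x (L - {y0})) = card L"
    using fin y0_L x_notin card_L by simp
  moreover have "V2 \<inter> insert x (L - {y0}) = {}" by (auto simp: V2_def)
  then have "card V1 = card V2 + card (insert x (L - {y0}))"
    unfolding V1_eq using fin by (intro card_Un_disjoint) auto
  ultimately show ?thesis by simp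
qed

lemma card_V: "card V = card V1 + 1"
proof -
  have "y0 \<in> V" using in_V xy0 by blast
  then show ?thesis using finV card_gt_0_iff[of V] unfolding V1_def by (auto simp: card_Diff_singleton)
qed

lemma conn_V2: "cut_connected V2 E"
  unfolding V2_def
proof (rule cut_connected_Diff[where p = p])
  show "v \<in> insert p (insert x L)" if "u \<in> insert x L" "(u, v) \<in> E" for u v
    using that L_leaf[of u] by (auto simp: L_def leaf_at_def)
qed (use conn E_sym in_V xp x_notin in \<open>auto simp: L_def\<close>)

lemma nbr_p: obtains a where "a \<in> V2" "(p, a) \<in> E" "a \<noteq> p"
proof -
  have "{p} \<subseteq> V2" "{p} \<noteq> V2" using p_V2 t_V2 t by auto
  then show ?thesis using conn_V2 that by (blast elim: cut_connectedE)
qed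

lemma nbr_V2: "\<lbrakk>u \<in> V2; u \<noteq> p; (u, v) \<in> E\<rbrakk> \<Longrightarrow> v \<in> V2"
  using E_sym[of u v] in_V[of u v] L_leaf[of v] L_leaf[of u] by (auto simp: V2_def L_def leaf_at_def)

section \<open>Host neighbourhoods seen from the tree\<close>

lemma inj_f: "inj_on f V1" and f_edge: "\<lbrakk>(u, v) \<in> E; u \<in> V1; v \<in> V1\<rbrakk> \<Longrightarrow> f v \<in> N (\<sigma> u) (f u)"
  using emb_f by (auto simp: emb_def V1_def)

lemma f_eq: "\<lbrakk>u \<in> V1; v \<in> V1\<rbrakk> \<Longrightarrow> f u = f v \<longleftrightarrow> u = v"
  using inj_f by (auto simp: inj_on_def)

lemma S_V1: "S u \<subseteq> V1"
  by (auto simp: S_def)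

lemma S_irrefl: "u \<notin> S u"
  using N_irrefl by (auto simp: S_def)

lemma S_edge: "\<lbrakk>(u, v) \<in> E; u \<in> V1; v \<in> V1\<rbrakk> \<Longrightarrow> v \<in> S u"
  using f_edge by (auto simp: S_def)

lemma S_unique:
  assumes "u \<in> V1" "u' \<in> V1" "u \<noteq> u'" "v \<in> S u" "v \<in> S u'" "v' \<in> S u" "v' \<in> S u'"
  shows "v = v'"
proof -
  have "f v = f v'"
    using common_nbr_unique[of "f u" "f u'" "f v" "\<sigma> u" "\<sigma> u'" "f v'"] assms f_eq
    by (auto simp: S_def)
  then show ?thesis using assms f_eq S_V1 by blast
qed

text \<open>Placed neighbours of \<open>z\<close> lie in \<open>S z\<close>, which meets
  \<open>S u\<close> in at most one vertex.\<close>

lemma S_pack: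
  assumes "u \<in> V1" "z \<in> V1" "z \<noteq> u" "(z, v) \<in> E" "(z, v') \<in> E" "v \<in> S u" "v' \<in> S u"
  shows "v = v'"
proof -
  have "v \<in> S z" "v' \<in> S z" using assms S_edge S_V1 by blast+
  then show ?thesis using S_unique assms by metis
qed

text \<open>The images of \<open>u\<close>, \<open>u'\<close>, \<open>h\<close>, \<open>g\<close>
  would form a 4-cycle whose two arcs at \<open>f u\<close> both leave or both enter it.\<close>

lemma S_no_edge:
  assumes "u \<in> V1" "u' \<in> S u" "g \<in> S u" "g \<noteq> u'" "h \<in> S u'" "h \<noteq> u" "(g, h) \<in> E"
  shows False
proof -
  have V: "u' \<in> V1" "g \<in> V1" "h \<in> V1" using assms S_V1 by blast+
  have "f h \<in> N (\<sigma> g) (f g)" using f_edge assms V by blast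
  then show False
    using no_4cycle[of "f u'" "\<sigma> u" "f u" "f g" "f h" "\<sigma> u'" "\<sigma> g"] assms V f_eq
    by (auto simp: S_def)
qed

lemma card_S_Int: "\<lbrakk>u \<in> V1; u' \<in> V1; u \<noteq> u'\<rbrakk> \<Longrightarrow> card (S u \<inter> S u') \<le> 1"
  using S_unique[of u u'] fin(4) by (auto simp: card_le_Suc0_iff_eq)

text \<open>Without free neighbours, \<open>f\<close> maps \<open>S u\<close> onto the host
  neighbourhood. The \<open>+ 1\<close> in \<open>host_deg\<close> is absorbed by \<open>y0\<close>,
  which is missing from \<open>V1\<close>.\<close>

lemma card_S_saturated:
  assumes "N (\<sigma> u) (f u) \<subseteq> f ` V1" "u \<in> V1" "v \<in> V1" "(u, v) \<in> E"
  shows "card V1 \<le> 2 * card (S u)"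
proof -
  have "f ` S u = N (\<sigma> u) (f u)" using assms(1) by (auto simp: S_def)
  then have "card (S u) = card (N (\<sigma> u) (f u))"
    using inj_f S_V1[of u] by (metis card_image inj_on_subset)
  moreover have "N (\<sigma> u) (f u) \<noteq> {}" using f_edge assms by blast
  ultimately show ?thesis using host_deg[of "\<sigma> u" "f u"] card_V by simp
qed

lemma x_saturated: "N (\<sigma> x) (f x) \<subseteq> f ` V1"
proof
  fix u assume u: "u \<in> N (\<sigma> x) (f x)"
  show "u \<in> f ` V1"
  proof (rule ccontr)
    assume "u \<notin> f ` V1"
    then have "emb N \<sigma> E (f(y0 := u)) V"
      using emb_extend_leaf[OF emb_f, of x u] y0_leaf E_sym \<sigma> xy0 x_notin u by (auto simp: V1_def)
    then show False using not_emb by blast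
  qed
qed

text \<open>Otherwise \<open>y\<close> could move to a free neighbour of the image of \<open>z\<close>, vacating its place for \<open>y0\<close>.\<close>
lemma leaf_parent_saturated:
  assumes "y \<in> S x" "leaf_at E z y" "z \<noteq> x"
  shows "z \<in> V1" "N (\<sigma> z) (f z) \<subseteq> f ` V1"
proof -
  have zy: "(z, y) \<in> E" and y_leaf: "\<And>z'. (y, z') \<in> E \<Longrightarrow> z' = z"
    using assms by (auto simp: leaf_at_def)
  have y: "y \<in> V1" "y \<noteq> x" "y \<noteq> y0" using assms S_V1 S_irrefl by (auto simp: V1_def)
  have "z \<noteq> y0" using y0_leaf zy y by blast
  then show zV: "z \<in> V1" using in_V zy by (auto simp: V1_def)
  show "N (\<sigma> z) (f z) \<subseteq> f ` V1"
  proof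
    fix u assume u: "u \<in> N (\<sigma> z) (f z)"
    show "u \<in> f ` V1"
    proof (rule ccontr)
      assume nu: "u \<notin> f ` V1"
      have "emb N \<sigma> E f (V1 - {y})"
        using emb_f by (auto simp: emb_def V1_def inj_on_def)
      then have 1: "emb N \<sigma> E (f(y := u)) V1"
        by (rule emb_extend_leaf[where z = z]) (use y_leaf E_sym \<sigma>[OF zy] zy irrefl u nu in auto)
      have "f y \<notin> (f(y := u)) ` V1" using nu y f_eq by auto
      moreover have "f y \<in> N (\<sigma> x) ((f(y := u)) x)" using assms(1) y by (auto simp: S_def)
      ultimately have "emb N \<sigma> E ((f(y := u))(y0 := f y)) V"
        using emb_extend_leaf[OF 1[unfolded V1_def], of x "f y"] y0_leaf E_sym \<sigma> xy0 x_notin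
        by (auto simp: V1_def)
      then show False using not_emb by blast
    qed
  qed
qed

text \<open>Each set has at least half of the placed vertices and they overlap in at most one, so at
  most one placed vertex escapes both.\<close>

lemma card_uncovered:
  assumes "u \<in> V1" "u' \<in> V1" "u \<noteq> u'" "card V1 \<le> 2 * card (S u)" "card V1 \<le> 2 * card (S u')"
  shows "card V1 \<le> card (S u \<union> S u') + 1"
  using card_Un_Int[of "S u" "S u'"] fin(4) card_S_Int[OF assms(1-3)] assms(4,5) by simp

lemma card_S_x: "card V1 \<le> 2 * card (S x)"
  using card_S_saturated x_saturated x_V1 p_V1 xp by blast

lemma p_S_x: "p \<in> S x"
  using S_edge xp x_V1 p_V1 by blast

lemma L_S_x: "L - {y0} \<subseteq> S x"
  using S_edge x_V1 V1_eq by (auto simp: L_def)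

lemma card_S_x_V2: "card (S x) + 1 = card (S x - L) + card L"
proof -
  have "S x \<inter> L = L - {y0}" using L_S_x S_V1 by (auto simp: V1_def)
  moreover have "card (S x) = card (S x \<inter> L) + card (S x - L)"
    using fin card_Int_Diff[of "S x" L] by simp
  ultimately show ?thesis using y0_L fin card_L by simp
qed

lemma S_x_V2: "S x - L \<subseteq> V2"
  using S_V1 S_irrefl V1_eq by blast

end

section \<open>The inner neighbour is saturated\<close>

context near_embedding
begin

text \<open>The cut of \<open>V2\<close> formed by \<open>p\<close> and its neighbours misses
  \<open>t\<close>. An edge leaving it leads to a vertex \<open>b\<close> at distance two from
  \<open>p\<close>, which is not in \<open>Lt\<close> because its neighbour \<open>a\<close> is not
  \<open>t\<close>.\<close>

lemma far_nbr:
  assumes "(p, t) \<notin> E"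
  obtains a b where "a \<in> V2" "b \<in> V2" "(p, a) \<in> E" "(a, b) \<in> E" "a \<noteq> t" "b \<noteq> p" "b \<notin> Lt"
proof -
  define W where "W = insert p (E `` {p} \<inter> V2)"
  have "W \<subseteq> V2" "W \<noteq> {}" "W \<noteq> V2" using p_V2 t_V2 t assms by (auto simp: W_def)
  then obtain a b where ab: "a \<in> W" "b \<in> V2" "b \<notin> W" "(a, b) \<in> E"
    using conn_V2 by (blast elim: cut_connectedE)
  then have a: "a \<in> V2" "(p, a) \<in> E" "a \<noteq> t" using assms by (auto simp: W_def)
  moreover have "b \<noteq> p" using ab by (auto simp: W_def)
  moreover have "b \<notin> Lt" using Lt E_sym[OF ab(4)] a(3) by (auto simp: leaf_at_def)
  ultimately show ?thesis using that ab by blast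
qed

lemma p_saturated: "N (\<sigma> p) (f p) \<subseteq> f ` V1"
proof (rule ccontr)
  assume "\<not> ?thesis"
  then obtain w where w: "w \<in> N (\<sigma> p) (f p)" "w \<notin> f ` V1" by blast
  have w_ne: "w \<noteq> f u" if "u \<in> V1" for u using w(2) that by blast
  have fpw: "f p \<in> N (\<sigma> x) w" using w(1) N_sym[of w "\<sigma> p" "f p"] \<sigma>[OF xp] by simp
  \<comment> \<open>\<open>w\<close> is a second possible position of \<open>x\<close>, and
    \<open>Sw\<close> corresponds to \<open>S x\<close> there. Below, \<open>R\<close> collects the
    host neighbours of \<open>w\<close> that are free once \<open>x\<close> and its leaves are taken
    up.\<close>
  define Sw where "Sw = {v \<in> V2. f v \<in> N (\<sigma> x) w}"
  have Sw: "Sw \<subseteq> V2" "p \<in> Sw" using fpw p_V2 by (auto simp: Sw_def)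
  have finSw: "finite Sw" using Sw(1) fin finite_subset by blast
  define R where "R = N (\<sigma> x) w - f ` V2"
  have finR: "finite R" using N_finite by (simp add: R_def)
  have VV: "V2 \<union> {x} \<union> L = V" using V1_eq in_V xp by (auto simp: V2_def L_def)
  have star: False
    if "emb N \<sigma> E g V2" "g p = f p" "w \<notin> g ` V2" "M \<subseteq> N (\<sigma> x) w" "M \<inter> g ` V2 = {}" "card L \<le> card M"
    for g M
  proof -
    have "\<exists>h. emb N \<sigma> E h (V2 \<union> {x} \<union> L)"
      by (rule emb_extend_star[OF that(1), where p = p and w = w and M = M])
        (use that w E_sym \<sigma> x_notin xp fin L_leaf p_V2 in \<open>auto simp: V2_def L_def\<close>)
    then show False using not_emb VV by simp
  qed
  have f_V2: "emb N \<sigma> E f V2"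
    using emb_f V2_V1 unfolding emb_def V1_def by (auto intro: inj_on_subset)
  have R: "card R < card L"
    using star[OF f_V2, of R] w(2) V2_V1 by (fastforce simp: R_def)
  have "f ` Sw = N (\<sigma> x) w - R" using Sw(1) by (auto simp: Sw_def R_def)
  then have "card (N (\<sigma> x) w - R) = card Sw"
    using inj_f Sw(1) V2_V1 by (metis card_image inj_on_subset)
  moreover have "card (N (\<sigma> x) w - R) + card R = card (N (\<sigma> x) w)"
    using N_finite[of "\<sigma> x" w] by (metis R_def Diff_subset card_Diff_subset card_mono finR le_add_diff_inverse2)
  ultimately have cw: "card V1 \<le> 2 * (card Sw + card R)"
    using host_deg[of "\<sigma> x" w] fpw card_V by auto
  have Sw_unique: "v = v'" if "v \<in> V2" "v' \<in> V2" "f v \<in> N s u" "f v' \<in> N s u" "u \<noteq> w" "v \<in> Sw" "v' \<in> Sw" for v v' s u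
    using common_nbr_unique[of u w "f v" s "\<sigma> x" "f v'"] that f_eq V2_V1 by (auto simp: Sw_def)
  have Int: "(S x - L) \<inter> Sw = {p}"
  proof -
    have "v = p" if v: "v \<in> S x" "v \<in> Sw" for v
    proof -
      have "f v \<in> N (\<sigma> x) (f x)" "f p \<in> N (\<sigma> x) (f x)" "v \<in> V2"
        using v p_S_x Sw(1) by (auto simp: S_def)
      then show ?thesis using Sw_unique[OF _ p_V2] w_ne[OF x_V1] v Sw(2) by metis
    qed
    then show ?thesis using p_S_x Sw(2) x_notin(2) by blast
  qed
  define U where "U = (S x - L) \<union> Sw"
  have finU: "finite U" using fin finSw by (simp add: U_def)
  have U_V2: "U \<subseteq> V2" using S_x_V2 Sw by (simp add: U_def)
  have cU: "card U + 1 = card (S x - L) + card Sw"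
    using card_Un_Int[of "S x - L" Sw] Int fin finSw by (simp add: U_def)
  have cO: "card (V2 - U) + card U = card V2"
    using U_V2 fin by (metis card_Diff_subset card_mono finU le_add_diff_inverse2)
  \<comment> \<open>Both positions have at least \<open>card V1 / 2\<close> host neighbours. Adding
    the two bounds, \<open>card L\<close> cancels and at most \<open>card R\<close> vertices of
    \<open>V2\<close> are adjacent to neither position.\<close>
  have count: "card (V2 - U) \<le> card R"
  proof -
    have "o' \<le> r"
      if "k \<le> 2 * (s + r)" "u + 1 = s' + s" "o' + u = v2" "k = v2 + q" "k \<le> 2 * n" "n + 1 = s' + q"
      for k s r u s' o' v2 q n :: nat
      using that by simp
    from this[OF cw cU cO card_V1 card_S_x card_S_x_V2] show ?thesis .
  qed
  have nbr_U: "v = v'" if "z \<in> V2" "(z, v) \<in> E" "(z, v') \<in> E" "v \<in> S x \<and> v' \<in> S x \<or> v \<in> Sw \<and> v' \<in> Sw" for z v v'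
    using that(4)
  proof
    assume "v \<in> S x \<and> v' \<in> S x"
    then show ?thesis using S_pack[of x z v v'] that x_V1 V2_V1 by (auto simp: V2_def)
  next
    assume *: "v \<in> Sw \<and> v' \<in> Sw"
    then have "f v \<in> N (\<sigma> z) (f z)" "f v' \<in> N (\<sigma> z) (f z)"
      using f_edge that(1-3) Sw(1) V2_V1 by blast+
    moreover have "v \<in> V2" "v' \<in> V2" "f z \<noteq> w" using * Sw(1) w_ne that(1) V2_V1 by blast+
    ultimately show ?thesis using Sw_unique * by blast
  qed
  text \<open>So a vertex at distance two from \<open>p\<close> is adjacent to neither of the two positions of \<open>x\<close>.\<close>
  have second: "b \<notin> U" if "a \<in> V2" "(p, a) \<in> E" "(a, b) \<in> E" "b \<noteq> p" for a b
    using nbr_U[of a b p] that E_sym p_S_x Sw by (auto simp: U_def)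
  show False
  proof (cases "(p, t) \<in> E")
    case True
    \<comment> \<open>The leaves of \<open>t\<close> are now at distance two from \<open>p\<close>,
      hence all uncovered; that is too many, as \<open>card R < card L\<close>.\<close>
    have "Lt \<inter> U = {}" using second[OF t_V2 True] Lt p_Lt unfolding leaf_at_def by blast
    then have "Lt \<subseteq> V2 - U" using Lt_V2 by blast
    then have "card Lt \<le> card (V2 - U)" using fin by (meson card_mono finite_Diff)
    then show False using count R card_L(1) by simp
  next
    case False
    then obtain a b where ab: "a \<in> V2" "b \<in> V2" "(p, a) \<in> E" "(a, b) \<in> E" "a \<noteq> t" "b \<noteq> p" "b \<notin> Lt"
      by (rule far_nbr)
    have b: "b \<in> V2 - U" using second ab by blast
    have "\<forall>v\<in>Lt \<inter> S x. \<forall>v'\<in>Lt \<inter> S x. v = v'" "\<forall>v\<in>Lt \<inter> Sw. \<forall>v'\<in>Lt \<inter> Sw. v = v'"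
      using nbr_U[OF t_V2] Lt unfolding leaf_at_def by blast+
    then have c1: "card (Lt \<inter> S x) \<le> 1" "card (Lt \<inter> Sw) \<le> 1"
      using fin by (simp_all add: card_le_Suc0_iff_eq)
    have "Lt - (S x \<union> Sw) \<subseteq> V2 - U - {b}" using Lt_V2 ab(7) by (auto simp: U_def)
    then have "card (Lt - (S x \<union> Sw)) \<le> card (V2 - U - {b})"
      using fin by (meson card_mono finite_Diff)
    then have c2: "card (Lt - (S x \<union> Sw)) + 1 \<le> card (V2 - U)"
      using b fin card_gt_0_iff[of "V2 - U"] by (auto simp: card_Diff_singleton)
    have "Lt = (Lt - (S x \<union> Sw)) \<union> ((Lt \<inter> S x) \<union> (Lt \<inter> Sw))" by auto
    then have "card Lt \<le> card (Lt - (S x \<union> Sw)) + card ((Lt \<inter> S x) \<union> (Lt \<inter> Sw))"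
      by (metis card_Un_le)
    then have c3: "card Lt \<le> card (Lt - (S x \<union> Sw)) + (card (Lt \<inter> S x) + card (Lt \<inter> Sw))"
      using card_Un_le[of "Lt \<inter> S x" "Lt \<inter> Sw"] by linarith
    \<comment> \<open>At most one leaf of \<open>t\<close> lies in each neighbourhood, and
      \<open>b\<close> is one more uncovered vertex. Against
      \<open>card R < card L \<le> card Lt\<close> there is no slack: both intersections are
      nonempty and \<open>R\<close> is short of one place only.\<close>
    have "card (Lt \<inter> S x) \<noteq> 0" "card (Lt \<inter> Sw) \<noteq> 0" and rL: "card L \<le> card R + 1"
      using count R c1 c2 c3 card_L(1) by linarith+
    then obtain y y' where y: "y \<in> Lt" "y \<in> S x" and y': "y' \<in> Lt" "y' \<in> Sw"
      by (metis Int_iff card.empty ex_in_conv)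
    have t_sat: "N (\<sigma> t) (f t) \<subseteq> f ` V1"
      using leaf_parent_saturated(2)[OF y(2) Lt[OF y(1)]] t by blast
    have ty': "(t, y') \<in> E" using Lt[OF y'(1)] by (simp add: leaf_at_def)
    have y'_V2: "y' \<in> V2" using y' Sw by blast
    \<comment> \<open>Otherwise \<open>y'\<close> could move to the place vacated by
      \<open>x\<close>, and its old place is the one neighbour of \<open>w\<close> that was
      lacking.\<close>
    have "x \<notin> S t"
    proof
      assume "x \<in> S t"
      then have fx: "f x \<in> N (\<sigma> t) (f t)" by (simp add: S_def)
      have fx_V2: "f x \<notin> f ` V2" using f_eq x_V1 V2_V1 by (auto simp: V2_def)
      define g where "g = f(y' := f x)"
      have "emb N \<sigma> E f (V2 - {y'})" using f_V2 by (auto simp: emb_def inj_on_def)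
      then have "emb N \<sigma> E g V2"
        unfolding g_def
      proof (rule emb_extend_leaf[where z = t])
        show "z' = t" if "(y', z') \<in> E" for z' using Lt[OF y'(1)] that by (simp add: leaf_at_def)
        show "z' = t" if "(z', y') \<in> E" for z' using Lt[OF y'(1)] E_sym[OF that] by (simp add: leaf_at_def)
      qed (use \<sigma>[OF ty'] irrefl[OF ty'] fx fx_V2 in auto)
      moreover have g_img: "g ` V2 \<subseteq> insert (f x) (f ` (V2 - {y'}))" by (auto simp: g_def)
      have fy'_ne: "f y' \<notin> f ` (V2 - {y'})" "f y' \<noteq> f x"
        using f_eq y'_V2 V2_V1 x_V1 by (auto simp: V2_def subset_iff)
      \<comment> \<open>Else \<open>f x\<close> and \<open>f y'\<close> would be two common
        neighbours of \<open>f t\<close> and \<open>w\<close>.\<close>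
      have "f x \<notin> R"
      proof
        assume "f x \<in> R"
        then have "f x = f y'"
          using common_nbr_unique[of "f t" w "f x" "\<sigma> t" "\<sigma> x" "f y'"] fx y' f_edge[OF ty'] w_ne
            t_V1 y'_V2 V2_V1 by (auto simp: R_def Sw_def)
        then show False using fy'_ne by simp
      qed
      then have "insert (f y') R \<inter> g ` V2 = {}" using g_img fy'_ne by (auto simp: R_def)
      moreover have "insert (f y') R \<subseteq> N (\<sigma> x) w" using y' by (auto simp: R_def Sw_def)
      moreover have "card L \<le> card (insert (f y') R)"
        using rL finR y'_V2 by (simp add: R_def)
      moreover have "g p = f p" using y'(1) p_Lt by (auto simp: g_def)
      moreover have "w \<notin> g ` V2" using g_img w_ne x_V1 V2_V1 by blast
      ultimately show False using star by blast
    qed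
    \<comment> \<open>As \<open>x\<close> lies in neither set, it is the one vertex that two
      saturated neighbourhoods can miss; all other placed vertices are covered.\<close>
    then have sub: "S x \<union> S t \<subseteq> V1 - {x}" using S_V1 S_irrefl by blast
    have "card V1 \<le> 2 * card (S t)"
      using card_S_saturated[OF t_sat t_V1 _ ty'] y'_V2 V2_V1 by blast
    then have "card V1 \<le> card (S x \<union> S t) + 1"
      using card_uncovered[OF x_V1 t_V1] t card_S_x by blast
    then have "card (V1 - {x}) \<le> card (S x \<union> S t)" using x_V1 fin by simp
    then have cover: "S x \<union> S t = V1 - {x}"
      using sub fin by (meson card_seteq finite_Diff)
    then have t_Sx: "t \<in> S x" using t_V1 t S_irrefl by blast
    have ne: "a \<noteq> x" "b \<noteq> x" "p \<noteq> t" using ab t by (auto simp: V2_def)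
    have b_Sx: "b \<notin> S x" using second ab b by (auto simp: U_def V2_def)
    then have b_St: "b \<in> S t" using cover ab V2_V1 ne by blast
    \<comment> \<open>Either alternative closes a forbidden 4-cycle through the images of
      \<open>x\<close> and \<open>t\<close>: with \<open>a\<close> and \<open>b\<close> in the first
      case, with \<open>p\<close> and \<open>a\<close> in the second.\<close>
    have "a \<in> S x \<or> a \<in> S t" using cover ab V2_V1 ne by blast
    then show False
    proof
      assume "a \<in> S x"
      then show False using S_no_edge[OF x_V1 t_Sx _ _ b_St] ab ne by blast
    next
      assume "a \<in> S t"
      then show False using S_no_edge[OF x_V1 t_Sx p_S_x] ab ne by blast
    qed
  qed
qed

end

section \<open>Two saturated adjacent vertices\<close>

context near_embedding
begin

lemma card_S_p: "card V1 \<le> 2 * card (S p)"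
  using card_S_saturated[OF p_saturated p_V1 x_V1 E_sym[OF xp]] .

lemma uncovered_unique:
  assumes "v \<in> V1" "v \<notin> S x" "v \<notin> S p" "v' \<in> V1" "v' \<notin> S x" "v' \<notin> S p"
  shows "v = v'"
proof (rule ccontr)
  assume "v \<noteq> v'"
  have "S x \<union> S p \<subseteq> V1 - {v, v'}" using assms S_V1 by blast
  then have "card (S x \<union> S p) \<le> card (V1 - {v, v'})" using fin by (meson card_mono finite_Diff)
  moreover have "card (V1 - {v, v'}) + 2 = card V1"
  proof -
    have "card {v, v'} = 2" "{v, v'} \<subseteq> V1" using \<open>v \<noteq> v'\<close> assms by auto
    then show ?thesis using fin(1) by (metis card_Diff_subset card_mono finite_subset le_add_diff_inverse2)
  qed
  ultimately show False
    using card_uncovered[OF x_V1 p_V1 x_notin(3) card_S_x card_S_p] by linarith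
qed

text \<open>Together with saturation of a third vertex this bounds \<open>card V1\<close> by a small
  constant.\<close>

lemma card_third:
  assumes "u \<in> V1" "u \<noteq> x" "u \<noteq> p" "S u \<subseteq> S x \<union> S p \<union> Y" "finite Y"
  shows "card (S u) \<le> 2 + card Y"
proof -
  have "S u \<subseteq> (S u \<inter> S x) \<union> (S u \<inter> S p) \<union> Y" using assms(4) by blast
  then have "card (S u) \<le> card ((S u \<inter> S x) \<union> (S u \<inter> S p) \<union> Y)"
    using fin assms(5) by (intro card_mono) auto
  also have "\<dots> \<le> card (S u \<inter> S x) + card (S u \<inter> S p) + card Y"
    by (meson card_Un_le add_le_mono1 order_trans)
  finally show ?thesis using card_S_Int[OF assms(1) x_V1 assms(2)] card_S_Int[OF assms(1) p_V1 assms(3)] by linarith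
qed

text \<open>An edge leaving the set \<open>K\<close> of exceptions ends in the only vertex
  \<open>h\<close> outside \<open>S x\<close> and \<open>S p\<close>. Near \<open>h\<close> there is
  a leaf in \<open>S x\<close>; its parent is saturated with a tiny neighbourhood, so too few
  vertices are placed.\<close>

lemma S_x_near: "S x \<subseteq> L \<union> {p} \<union> E `` {p}"
proof (rule ccontr)
  define K where "K = S x - L - {p} - E `` {p}"
  assume "\<not> ?thesis"
  then have "K \<noteq> {}" by (auto simp: K_def)
  moreover have "K \<subseteq> V2" "K \<noteq> V2" using S_x_V2 p_V2 by (auto simp: K_def)
  ultimately obtain g h where gh: "g \<in> K" "h \<in> V2" "h \<notin> K" "(g, h) \<in> E"
    using conn_V2 by (blast elim: cut_connectedE)
  have hg: "(h, g) \<in> E" using E_sym gh(4) .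
  have g: "g \<in> S x" "g \<noteq> p" "(g, p) \<notin> E" "g \<in> V2" using gh(1) E_sym S_x_V2 by (auto simp: K_def)
  have ne: "h \<noteq> x" "g \<noteq> x" "h \<noteq> p" using gh g by (auto simp: V2_def)
  have V1: "g \<in> V1" "h \<in> V1" using gh g V2_V1 by auto
  have h_p: "h \<notin> S p" using S_no_edge[OF x_V1 p_S_x g(1,2) _ ne(1) gh(4)] by blast
  have h_x: "h \<notin> S x"
  proof
    assume "h \<in> S x"
    then have "(h, p) \<in> E" using gh(2,3) ne E_sym by (auto simp: K_def V2_def)
    then show False using S_pack[OF x_V1 V1(2) ne(1) _ hg p_S_x g(1)] g(2) by blast
  qed
  have h_only: "v = h" if "v \<in> V1" "v \<notin> S x" "v \<notin> S p" for v
    using uncovered_unique that V1(2) h_x h_p by blast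
  obtain a where a: "a \<in> V2" "(p, a) \<in> E" "a \<noteq> p" by (rule nbr_p)
  have a_p: "a \<in> S p" using S_edge a V2_V1 p_V1 by blast
  have a_ne: "a \<noteq> x" "a \<noteq> h" "a \<noteq> g" using a a_p h_p g(3) E_sym by (auto simp: V2_def)
  have five: "{x, p, a, h, g} \<subseteq> V1" using x_V1 p_V1 V1 a V2_V1 by auto
  have card5: "card {x, p, a, h, g} = 5"
    using a_ne a ne g(2) x_notin(3) irrefl[OF gh(4)] by auto
  show False
  proof (cases "leaf_at E h g")
    case True
    \<comment> \<open>\<open>h\<close> is saturated although \<open>S h\<close> has at most one
      vertex in each of \<open>S x\<close> and \<open>S p\<close>: at most four vertices are placed,
      but five are named.\<close>
    note sat = leaf_parent_saturated[OF g(1) True ne(1)]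
    have "card V1 \<le> 2 * card (S h)" using card_S_saturated[OF sat(2,1) V1(1) hg] .
    moreover have "S h \<subseteq> S x \<union> S p \<union> {}" using h_only S_irrefl S_V1 by blast
    then have "card (S h) \<le> 2" using card_third[OF V1(2) ne(1,3), of "{}"] by simp
    ultimately show False using card_mono[OF fin(1) five] card5 by linarith
  next
    case False
    then obtain g' where g': "(g, g') \<in> E" "g' \<noteq> h" using hg by (auto simp: leaf_at_def)
    have g'_V2: "g' \<in> V2" using nbr_V2 g g'(1) by blast
    have g'_ne: "g' \<noteq> x" "g' \<noteq> p" "g' \<noteq> g" using g'_V2 g(3) g'(1) irrefl by (auto simp: V2_def)
    have g'_V1: "g' \<in> V1" using g'_V2 V2_V1 by blast
    have g'_p: "g' \<notin> S p" using S_no_edge[OF x_V1 p_S_x g(1,2) _ g'_ne(1) g'(1)] by blast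
    have g'_x: "g' \<in> S x" using h_only g' g'_V1 g'_p by blast
    have g'p: "(g', p) \<notin> E"
      using S_pack[OF x_V1 g'_V1 g'_ne(1) _ E_sym[OF g'(1)] p_S_x g(1)] g(2) by blast
    \<comment> \<open>Another neighbour of \<open>g'\<close> could only be the uncovered
      \<open>h\<close>, which would then have the two neighbours \<open>g\<close> and
      \<open>g'\<close> in \<open>S x\<close>.\<close>
    have leaf: "leaf_at E g g'"
      unfolding leaf_at_def
    proof (intro conjI allI impI g'(1))
      fix z assume z: "(g', z) \<in> E"
      show "z = g"
      proof (rule ccontr)
        assume "z \<noteq> g"
        have z_V2: "z \<in> V2" using nbr_V2 g'_V2 g'_ne z by blast
        have "z \<notin> S x" using S_pack[OF x_V1 g'_V1 g'_ne(1) z E_sym[OF g'(1)] _ g(1)] \<open>z \<noteq> g\<close> by blast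
        moreover have "z \<notin> S p"
          using S_no_edge[OF x_V1 p_S_x g'_x g'_ne(2) _ _ z] z_V2 by (auto simp: V2_def)
        ultimately have "z = h" using h_only z_V2 V2_V1 by blast
        then show False using S_pack[OF x_V1 V1(2) ne(1) hg E_sym g(1) g'_x] z g'_ne by blast
      qed
    qed
    \<comment> \<open>Saturation of \<open>g\<close> leaves only the six named vertices. Among these
      \<open>S p\<close> contains at most \<open>x\<close> and \<open>a\<close>, too few for
      \<open>card_S_p\<close>.\<close>
    note sat = leaf_parent_saturated[OF g'_x leaf ne(2)]
    have "card V1 \<le> 2 * card (S g)" using card_S_saturated[OF sat(2,1) g'_V1 g'(1)] .
    moreover have "S g \<subseteq> S x \<union> S p \<union> {h}" using h_only S_V1 by blast
    then have "card (S g) \<le> 3" using card_third[OF V1(1) ne(2) g(2), of "{h}"] by simp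
    ultimately have "card V1 \<le> 6" by linarith
    moreover have six: "insert g' {x, p, a, h, g} \<subseteq> V1" using five g'_V1 by blast
    moreover have "card (insert g' {x, p, a, h, g}) = 6"
    proof -
      have "g' \<noteq> a" using g'p a E_sym by blast
      then have "g' \<notin> {x, p, a, h, g}" using g'_ne g'(2) by blast
      then show ?thesis using card5 by simp
    qed
    ultimately have V1_6: "insert g' {x, p, a, h, g} = V1"
      using fin(1) by (metis card_seteq)
    have "g \<notin> S p"
      using S_no_edge[OF x_V1 p_S_x g'_x g'_ne(2) _ ne(2) E_sym[OF g'(1)]] by blast
    moreover have "S p \<subseteq> insert g' {x, p, a, h, g}" using S_V1 V1_6 by simp
    ultimately have "S p \<subseteq> {x, a}"
      using S_irrefl[of p] h_p g'_p by blast
    then have "card (S p) \<le> 2"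
      using card_mono[of "{x, a}" "S p"] a_ne by simp
    then show False using card_S_p card_mono[OF fin(1) five] card5 by linarith
  qed
qed

text \<open>The one tree that escapes the counting is the path with four arcs.\<close>
lemma path_case:
  obtains l where "V = {y0, x, p, t, l}" "distinct [y0, x, p, t, l]" "(p, t) \<in> E" "(t, l) \<in> E"
    "\<And>u v. (u, v) \<in> E \<Longrightarrow> {u, v} \<in> {{y0, x}, {x, p}, {p, t}, {t, l}}"
proof -
  \<comment> \<open>By \<open>S_x_near\<close>, \<open>S x\<close> has besides \<open>p\<close> and
    the leaves of \<open>x\<close> only neighbours of \<open>p\<close>; two of those would
    contradict \<open>S_pack\<close>.\<close>
  define C where "C = S x \<inter> E `` {p}"
  have finC: "finite C" using fin by (simp add: C_def)
  have "\<forall>v\<in>C. \<forall>v'\<in>C. v = v'"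
    using S_pack[OF x_V1 p_V1] x_notin(3) by (auto simp: C_def)
  then have C1: "card C \<le> 1" using finC by (simp add: card_le_Suc0_iff_eq)
  have "S x \<subseteq> (L - {y0}) \<union> ({p} \<union> C)"
    using S_x_near S_V1 by (auto simp: C_def V1_def)
  then have "card (S x) \<le> card ((L - {y0}) \<union> ({p} \<union> C))"
    using fin finC by (intro card_mono) auto
  also have "\<dots> \<le> card (L - {y0}) + (1 + card C)"
    using card_Un_le[of "L - {y0}" "{p} \<union> C"] card_Un_le[of "{p}" C] by simp
  also have "\<dots> = card L + card C"
    using y0_L fin card_L by simp
  finally have Sx: "card (S x) \<le> card L + card C" .
  define B where "B = insert x (insert p (insert t ((L - {y0}) \<union> Lt)))"
  have B_V1: "B \<subseteq> V1"
    using V1_eq Lt_V2 p_V2 t_V2 by (auto simp: B_def)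
  have "card ((L - {y0}) \<union> Lt) = card (L - {y0}) + card Lt"
    using fin Lt_V2 by (intro card_Un_disjoint) (auto simp: V2_def)
  moreover have t_Lt: "t \<notin> Lt" using Lt irrefl unfolding leaf_at_def by blast
  then have "t \<notin> (L - {y0}) \<union> Lt" using t_V2 by (auto simp: V2_def)
  moreover have "p \<notin> insert t ((L - {y0}) \<union> Lt)" using p_Lt x_notin t by auto
  moreover have "x \<notin> insert p (insert t ((L - {y0}) \<union> Lt))" using Lt_V2 x_notin t by (auto simp: V2_def)
  ultimately have cB: "card B = card L + card Lt + 2"
    using y0_L fin card_L by (simp add: B_def)
  have "card B \<le> card V1" using card_mono[OF fin(1) B_V1] .
  \<comment> \<open>\<open>card V1 \<le> 2 * card (S x) \<le> 2 * card L + 2 \<le> card L + card Lt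
    + 2 = card B\<close>, so equality holds throughout.\<close>
  then have eq: "card C = 1" "card Lt = card L" "card V1 = card B"
    using cB Sx C1 card_L(1) card_S_x by linarith+
  then have V1_B: "V1 = B" using card_seteq[OF fin(1) B_V1] by simp
  obtain c where "c \<in> C" using eq(1) by (metis card.empty ex_in_conv zero_neq_one)
  then have c: "c \<in> S x" "(p, c) \<in> E" by (auto simp: C_def)
  have "c \<in> B" using c S_V1 V1_B by blast
  moreover have "c \<notin> L" using L_leaf E_sym[OF c(2)] x_notin by (auto simp: leaf_at_def)
  moreover have "c \<notin> Lt" using Lt E_sym[OF c(2)] t by (auto simp: leaf_at_def)
  moreover have "c \<noteq> x" "c \<noteq> p" using c S_irrefl irrefl by auto
  ultimately have "c = t" by (auto simp: B_def)
  then have t_Sx: "t \<in> S x" and pt: "(p, t) \<in> E" using c by auto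
  \<comment> \<open>Leaves of \<open>t\<close> are missed by both neighbourhoods, so there is just
    one: \<open>t\<close> already has its neighbour \<open>p\<close> in \<open>S x\<close>, and an
    edge from \<open>t\<close> into \<open>S p\<close> closes a forbidden 4-cycle.\<close>
  have uncov: "l \<in> V1" "l \<notin> S x" "l \<notin> S p" if "l \<in> Lt" for l
  proof -
    have tl: "(t, l) \<in> E" using Lt[OF that] by (simp add: leaf_at_def)
    show "l \<in> V1" using that Lt_V2 V2_V1 by blast
    show "l \<notin> S x"
      using S_pack[OF x_V1 t_V1 t(2) tl E_sym[OF pt] _ p_S_x] that p_Lt by blast
    show "l \<notin> S p"
      using S_no_edge[OF x_V1 p_S_x t_Sx t(3) _ _ tl] that Lt_V2 by (auto simp: V2_def)
  qed
  then have "\<forall>l\<in>Lt. \<forall>l'\<in>Lt. l = l'" using uncovered_unique by blast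
  then have "card Lt \<le> 1" using fin by (simp add: card_le_Suc0_iff_eq)
  then have "card Lt = 1" "card L = 1" using eq card_L by linarith+
  then obtain l where l: "Lt = {l}" "L = {y0}" using y0_L by (metis card_1_singletonE singletonD)
  have leaf_l: "leaf_at E t l" using Lt l by blast
  have B_eq: "B = {x, p, t, l}" using l by (auto simp: B_def)
  have "y0 \<in> V" using in_V xy0 by blast
  then have V_eq: "V = {y0, x, p, t, l}" using V1_B B_eq by (auto simp: V1_def)
  have dist: "distinct [y0, x, p, t, l]"
  proof -
    have "y0 \<notin> B" using V1_B by (auto simp: V1_def)
    moreover have "l \<noteq> x" "l \<noteq> p" "l \<noteq> t"
      using Lt_V2 p_Lt t_Lt l by (auto simp: V2_def)
    ultimately show ?thesis using B_eq x_notin(3) t(2,3) by auto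
  qed
  have "{u, v} \<in> {{y0, x}, {x, p}, {p, t}, {t, l}}" if uv: "(u, v) \<in> E" for u v
  proof -
    have x_nbr: "z \<in> {p, y0}" if "(x, z) \<in> E" for z
      using that l by (auto simp: L_def)
    have l_nbr: "z = t" if "(l, z) \<in> E" for z
      using that leaf_l by (simp add: leaf_at_def)
    have uV: "u \<in> {y0, x, p, t, l}" and vV: "v \<in> {y0, x, p, t, l}" and "u \<noteq> v" and vu: "(v, u) \<in> E"
      using in_V[OF uv] V_eq irrefl[OF uv] E_sym[OF uv] by simp_all
    have y0: "u = y0 \<Longrightarrow> v = x" "v = y0 \<Longrightarrow> u = x" using y0_leaf uv vu by blast+
    have x: "u = x \<Longrightarrow> v = p \<or> v = y0" "v = x \<Longrightarrow> u = p \<or> u = y0" using x_nbr uv vu by blast+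
    have l: "u = l \<Longrightarrow> v = t" "v = l \<Longrightarrow> u = t" using l_nbr uv vu by blast+
    consider "u = y0" | "u = x" | "u = p" | "u = t" | "u = l" using uV by blast
    then show ?thesis
    proof cases
      case 3
      then have "v \<noteq> y0" "v \<noteq> l" using y0(2) l(2) dist by auto
      then have "v = x \<or> v = t" using vV \<open>u \<noteq> v\<close> 3 by blast
      then show ?thesis using 3 by blast
    next
      case 4
      then have "v \<noteq> y0" "v \<noteq> x" using y0(2) x(2) dist by auto
      then have "v = p \<or> v = l" using vV \<open>u \<noteq> v\<close> 4 by blast
      then show ?thesis using 4 by blast
    qed (use y0(1) x(1) l(1) in blast)+
  qed
  moreover have "(t, l) \<in> E" using leaf_l by (simp add: leaf_at_def)
  ultimately show ?thesis using that V_eq dist pt by blast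
qed

end

section \<open>Longest paths in trees\<close>

definition graph_path :: "'b set \<Rightarrow> ('b \<times> 'b) set \<Rightarrow> 'b list \<Rightarrow> bool" where
  "graph_path V E c \<longleftrightarrow> distinct c \<and> set c \<subseteq> V \<and> successively (\<lambda>u v. (u, v) \<in> E) c"

definition no_cycle :: "('b \<times> 'b) set \<Rightarrow> bool" where
  "no_cycle E \<longleftrightarrow>
     \<not> (\<exists>c. 3 \<le> length c \<and> distinct c \<and> successively (\<lambda>u v. (u, v) \<in> E) c \<and> (last c, hd c) \<in> E)"

locale utree =
  fixes V :: "'b set" and E :: "('b \<times> 'b) set"
  assumes finV: "finite V" and EV: "E \<subseteq> V \<times> V"
    and E_sym: "(u, v) \<in> E \<Longrightarrow> (v, u) \<in> E" and E_irrefl: "(u, u) \<notin> E"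
    and conn: "cut_connected V E" and acyc: "no_cycle E"
begin

text \<open>Any other neighbour on the path closes a cycle with the initial segment ending
  there.\<close>

lemma no_chord:
  assumes "graph_path V E (u # Q)" "z \<in> set Q" "(u, z) \<in> E"
  shows "z = hd Q"
proof (rule ccontr)
  assume "z \<noteq> hd Q"
  obtain r1 r2 where Q: "Q = r1 @ z # r2" using assms(2) by (meson split_list)
  then have "r1 \<noteq> []" using \<open>z \<noteq> hd Q\<close> by auto
  let ?c = "u # r1 @ [z]"
  have "3 \<le> length ?c" using \<open>r1 \<noteq> []\<close> by (cases r1) auto
  moreover have "distinct ?c" using assms(1) Q by (auto simp: graph_path_def)
  moreover have "successively (\<lambda>u v. (u, v) \<in> E) (?c @ r2)"
    using assms(1) Q by (simp add: graph_path_def)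
  then have "successively (\<lambda>u v. (u, v) \<in> E) ?c" by (simp only: successively_append_iff)
  moreover have "(last ?c, hd ?c) \<in> E" using E_sym[OF assms(3)] by simp
  ultimately show False using acyc unfolding no_cycle_def by blast
qed

text \<open>Replacing \<open>a\<close> by \<open>u\<close> gives another longest path. It cannot be
  prolonged and has no chords, so \<open>b\<close> is the only neighbour of
  \<open>u\<close>.\<close>

lemma longest_path_end:
  assumes P: "graph_path V E (a # b # rest)"
    and longest: "\<And>Q. graph_path V E Q \<Longrightarrow> length Q \<le> length (a # b # rest)"
    and u: "(b, u) \<in> E" "rest = [] \<or> u \<noteq> hd rest"
  shows "leaf_at E b u"
proof -
  have bP: "graph_path V E (b # rest)" using P by (auto simp: graph_path_def)
  have "u \<notin> set rest" using no_chord[OF bP _ u(1)] u(2) by auto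
  moreover have "u \<noteq> b" "u \<in> V" "(u, b) \<in> E" using u E_irrefl EV E_sym by auto
  ultimately have uP: "graph_path V E (u # b # rest)" using bP by (auto simp: graph_path_def)
  have "z = b" if z: "(u, z) \<in> E" for z
  proof -
    have zu: "z \<noteq> u" "z \<in> V" "(z, u) \<in> E" using z E_irrefl EV E_sym by auto
    have "z \<in> set (b # rest)"
    proof (rule ccontr)
      assume "z \<notin> set (b # rest)"
      then have "graph_path V E (z # u # b # rest)" using uP zu by (auto simp: graph_path_def)
      then show False using longest by fastforce
    qed
    then show ?thesis using no_chord[OF uP _ z] by simp
  qed
  then show ?thesis using u by (simp add: leaf_at_def)
qed

text \<open>On a longest path with at least four vertices, the second and the last but one are
  distinct and penultimate; a shorter longest path means a star.\<close>

lemma star_or_penultimates: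
  assumes "2 \<le> card V"
  obtains (star) c where "c \<in> V" "\<And>u. (c, u) \<in> E \<Longrightarrow> leaf_at E c u"
  | (two) x p t p' where "x \<noteq> t" "penultimate E x p" "penultimate E t p'"
proof -
  obtain v where "v \<in> V" using assms by fastforce
  moreover have "{v} \<noteq> V" using assms by auto
  ultimately obtain w where "(v, w) \<in> E" "w \<noteq> v" "w \<in> V"
    using conn by (blast elim: cut_connectedE[where W = "{v}"])
  then have vw: "graph_path V E [v, w]" using \<open>v \<in> V\<close> by (simp add: graph_path_def)
  have "length Q < card V + 1" if "graph_path V E Q" for Q
  proof -
    have "card (set Q) = length Q" "set Q \<subseteq> V" using that by (auto simp: graph_path_def distinct_card)
    then show ?thesis using card_mono[OF finV, of "set Q"] by simp
  qed
  then have "\<exists>P. graph_path V E P \<and> (\<forall>Q. graph_path V E Q \<longrightarrow> length Q \<le> length P)"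
    using vw by (intro ex_has_greatest_nat[where k = "[v, w]" and b = "card V + 1"]) blast+
  then obtain P where P: "graph_path V E P" and longest: "\<And>Q. graph_path V E Q \<Longrightarrow> length Q \<le> length P"
    by blast
  have "2 \<le> length P" using longest[OF vw] by simp
  then obtain a b rest where P_eq: "P = a # b # rest"
    by (cases P; cases "tl P") auto
  have revP: "graph_path V E (rev P)"
    using P E_sym by (auto simp: graph_path_def successively_rev intro: successively_mono)
  have end1: "leaf_at E b u" if "(b, u) \<in> E" "rest = [] \<or> u \<noteq> hd rest" for u
    using longest_path_end[of a b rest u] P longest that unfolding P_eq by blast
  have b: "b \<in> V" using P P_eq by (auto simp: graph_path_def)
  show ?thesis
  proof (cases rest)
    case Nil
    then show ?thesis using star[of b] b end1 by blast
  next
    case (Cons c rest2)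
    obtain a' b' rest' where rP: "rev P = a' # b' # rest'"
      using P_eq by (cases "rev P"; cases "tl (rev P)") auto
    have end2: "leaf_at E b' u" if "(b', u) \<in> E" "rest' = [] \<or> u \<noteq> hd rest'" for u
      using longest_path_end[of a' b' rest' u] revP longest that rP
      by (metis length_rev)
    have ab: "(b, a) \<in> E" "(b, c) \<in> E" "a \<noteq> c"
      using P P_eq Cons E_sym by (auto simp: graph_path_def)
    show ?thesis
    proof (cases "rest2 = []")
      case True
      then have "rev P = [c, b, a]" using P_eq Cons by simp
      then have "b' = b" "rest' = [a]" using rP by auto
      then show ?thesis using star[of b] b end1 end2 ab Cons by (metis list.sel(1))
    next
      case False
      have pen1: "penultimate E b c"
        using ab end1 Cons by (auto simp: penultimate_def)
      have P2: "P = rev rest' @ [b', a']" using rP by (metis append_Cons append_Nil append_assoc rev.simps(2) rev_rev_ident)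
      have len: "length P \<ge> 4" using False Cons P_eq by (cases rest2) auto
      have "length (rev P) = length rest' + 2" using rP by simp
      then have len': "length rest' \<ge> 2" using len by simp
      then obtain c' rest2' where c': "rest' = c' # rest2'" by (cases rest') auto
      have revE: "distinct (a' # b' # c' # rest2')" "(a', b') \<in> E" "(b', c') \<in> E"
        using revP unfolding rP c' graph_path_def by auto
      have "penultimate E b' c'"
        using revE end2 c' E_sym by (auto simp: penultimate_def)
      moreover have "b \<noteq> b'"
      proof
        assume "b = b'"
        have "rev P ! 1 = b'" using rP by simp
        moreover have "rev P ! 1 = P ! (length P - 2)" using len by (simp add: rev_nth numeral_2_eq_2)
        moreover have "P ! 1 = b" using P_eq by simp
        moreover have "distinct P" using P by (simp add: graph_path_def)
        ultimately have "1 = length P - 2"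
          using \<open>b = b'\<close> len nth_eq_iff_index_eq[of P 1 "length P - 2"] by simp
        then show False using len by simp
      qed
      ultimately show ?thesis using two pen1 by blast
    qed
  qed
qed

lemma delete_leaf:
  assumes "y \<in> V" "leaf_at E x y" "V' = V - {y}"
  shows "utree V' (E \<inter> V' \<times> V')"
proof
  have x: "x \<in> V" "x \<noteq> y" using assms EV E_irrefl by (auto simp: leaf_at_def)
  have "cut_connected V' E"
    unfolding assms(3)
    by (rule cut_connected_Diff[OF conn, where p = x])
      (use assms x E_sym in \<open>auto simp: leaf_at_def\<close>)
  then show "cut_connected V' (E \<inter> V' \<times> V')"
    unfolding cut_connected_def by blast
  show "no_cycle (E \<inter> V' \<times> V')"
    using acyc unfolding no_cycle_def
    by (metis (mono_tags, lifting) IntD1 successively_mono)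
qed (use finV EV E_sym E_irrefl assms in auto)

end

section \<open>Stars, double stars, the path with four arcs, and the induction\<close>

context c4_host
begin

text \<open>The leaves are confined to a prescribed \<open>M\<close>, so that the second star of a
  double star finds its places unoccupied.\<close>

lemma emb_star:
  assumes L: "finite L" "\<And>l. l \<in> L \<Longrightarrow> leaf_at E c l" "c \<notin> L" "(c, c) \<notin> E"
    and sym: "\<And>u v. (u, v) \<in> E \<Longrightarrow> (v, u) \<in> E"
    and \<sigma>: "\<And>u v. (u, v) \<in> E \<Longrightarrow> \<sigma> u \<noteq> \<sigma> v"
    and M: "M \<subseteq> N (\<sigma> c) v0" "card L \<le> card M"
  obtains f where "emb N \<sigma> E f (insert c L)" "f c = v0" "f ` L \<subseteq> M"
proof -
  have "finite M" using M(1) N_finite finite_subset by blast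
  then obtain h where h: "inj_on h L" "h ` L \<subseteq> M"
    using card_le_inj[OF L(1) _ M(2)] by auto
  have v0: "v0 \<notin> M" using M(1) N_irrefl by blast
  define f where "f = h(c := v0)"
  have fL: "f l = h l" if "l \<in> L" for l using that L(3) by (auto simp: f_def)
  have img: "f ` L = h ` L" using fL by (auto intro: image_cong)
  have "inj_on f L" using h fL by (auto simp: inj_on_def)
  moreover have "f c \<notin> f ` L" unfolding img using h(2) v0 by (auto simp: f_def)
  ultimately have "inj_on f (insert c L)" using L(3) by (simp add: inj_on_insert)
  moreover have "f v \<in> N (\<sigma> u) (f u)" if uv: "u \<in> insert c L" "v \<in> insert c L" "(u, v) \<in> E" for u v
  proof (cases "u = c")
    case True
    then have "v \<in> L" using uv L(4) by auto
    then have "h v \<in> N (\<sigma> c) v0" using h(2) M(1) by blast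
    then show ?thesis using True fL[OF \<open>v \<in> L\<close>] by (simp add: f_def)
  next
    case False
    then have "u \<in> L" using uv by auto
    then have "v = c" using L(2) uv(3) by (auto simp: leaf_at_def)
    have "h u \<in> N (\<sigma> c) v0" using h(2) M(1) \<open>u \<in> L\<close> by blast
    then show ?thesis
      using N_sym[of "h u" "\<sigma> c" v0] \<sigma>[OF uv(3)] \<open>v = c\<close> fL[OF \<open>u \<in> L\<close>] by (simp add: f_def)
  qed
  ultimately have "emb N \<sigma> E f (insert c L)" by (simp add: emb_def)
  moreover have "f c = v0" "f ` L \<subseteq> M" unfolding img using h(2) by (simp_all add: f_def)
  ultimately show ?thesis using that by blast
qed

text \<open>The centre \<open>r\<close> goes to \<open>v0\<close>. The places \<open>Q\<close> for
  the leaves of \<open>x\<close> are chosen first: they take at most one vertex from the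
  neighbourhood of \<open>v0\<close>, and \<open>x\<close> takes another, which the surplus degree
  of \<open>v0\<close> allows.\<close>

lemma emb_double_star:
  assumes tree: "utree V E" and \<sigma>: "\<And>u v. (u, v) \<in> E \<Longrightarrow> \<sigma> u \<noteq> \<sigma> v"
    and deg: "\<And>s w. N s w \<noteq> {} \<Longrightarrow> card V \<le> 2 * card (N s w) + 1"
    and pen: "penultimate E x r" "penultimate E r x"
    and le: "card (E `` {x} - {r}) \<le> card (E `` {r} - {x})"
    and v0: "card (E `` {r}) < card (N (\<sigma> r) v0)"
  shows "\<exists>f. emb N \<sigma> E f V"
proof -
  interpret utree V E by (fact tree)
  define Lx where "Lx = E `` {x} - {r}"
  define Lr where "Lr = E `` {r} - {x}"
  have xr: "(x, r) \<in> E" "(r, x) \<in> E" "x \<noteq> r" "x \<in> V" "r \<in> V"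
    using pen E_irrefl EV by (auto simp: penultimate_def)
  have leaf: "\<And>l. l \<in> Lx \<Longrightarrow> leaf_at E x l" "\<And>l. l \<in> Lr \<Longrightarrow> leaf_at E r l"
    using pen by (auto simp: penultimate_def Lx_def Lr_def)
  have sub: "Lx \<subseteq> V" "Lr \<subseteq> V" using EV by (auto simp: Lx_def Lr_def)
  then have fin: "finite Lx" "finite Lr" using finV finite_subset by blast+
  have notin: "x \<notin> Lx" "r \<notin> Lx" "x \<notin> Lr" "r \<notin> Lr"
    using E_irrefl by (auto simp: Lx_def Lr_def)
  have disj: "Lx \<inter> Lr = {}"
  proof -
    have "x = r" if "l \<in> Lx" "l \<in> Lr" for l
      using leaf(2)[OF that(2)] E_sym[of x l] that(1) by (simp add: leaf_at_def Lx_def)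
    then show ?thesis using xr(3) by blast
  qed
  have V_eq: "V = insert r Lr \<union> {x} \<union> Lx"
  proof (rule ccontr)
    assume ne: "V \<noteq> insert r Lr \<union> {x} \<union> Lx"
    have "insert r Lr \<union> {x} \<union> Lx \<subseteq> V" using sub xr by auto
    then obtain u v where uv: "u \<in> insert r Lr \<union> {x} \<union> Lx" "v \<notin> insert r Lr \<union> {x} \<union> Lx" "(u, v) \<in> E"
      using cut_connectedE[OF conn _ _ ne[symmetric]] by (metis Un_empty insert_not_empty)
    then show False using leaf by (auto simp: leaf_at_def Lx_def Lr_def)
  qed
  have "card V = card (insert r Lr \<union> {x}) + card Lx"
    unfolding V_eq using fin notin disj xr by (intro card_Un_disjoint) auto
  then have card_V: "card V = card Lr + card Lx + 2" using fin notin xr by simp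
  have card_r: "card (E `` {r}) = card Lr + 1"
  proof -
    have "E `` {r} = insert x Lr" using xr by (auto simp: Lr_def)
    then show ?thesis using fin notin by simp
  qed
  obtain w where w: "w \<in> N (\<sigma> r) v0" using v0 by fastforce
  have sx: "\<sigma> x = (\<not> \<sigma> r)" using \<sigma>[OF xr(1)] by auto
  have wv: "v0 \<in> N (\<sigma> x) w" using w N_sym[of w "\<sigma> r" v0] sx by simp
  have "w \<noteq> v0" using w N_irrefl by blast
  \<comment> \<open>As \<open>card Lx \<le> card Lr\<close>, the bound makes the degree of
    \<open>w\<close> exceed \<open>card Lx\<close>, so \<open>v0\<close> can be spared.\<close>
  have "card V \<le> 2 * card (N (\<sigma> x) w) + 1" using deg[of "\<sigma> x" w] wv by blast
  then have "card Lx \<le> card (N (\<sigma> x) w - {v0})"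
    using card_V le wv N_finite[of "\<sigma> x" w] unfolding Lx_def[symmetric] Lr_def[symmetric]
    by (simp add: card_Diff_singleton)
  then obtain Q where Q: "Q \<subseteq> N (\<sigma> x) w - {v0}" "card Q = card Lx" "finite Q"
    by (meson obtain_subset_with_card_n)
  define M where "M = N (\<sigma> r) v0 - insert w (Q \<inter> N (\<sigma> r) v0)"
  have "card (Q \<inter> N (\<sigma> r) v0) \<le> card (N (\<sigma> r) v0 \<inter> N (\<sigma> x) w)"
    using N_finite Q by (intro card_mono) auto
  then have "card (Q \<inter> N (\<sigma> r) v0) \<le> 1"
    using card_Int_N_le[of v0 w "\<sigma> r" "\<sigma> x"] \<open>w \<noteq> v0\<close> by auto
  moreover have "card (insert w (Q \<inter> N (\<sigma> r) v0)) \<le> card (Q \<inter> N (\<sigma> r) v0) + 1"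
    using card_insert_le_m1[of "card (Q \<inter> N (\<sigma> r) v0) + 1" "Q \<inter> N (\<sigma> r) v0" w] by simp
  moreover have "card M = card (N (\<sigma> r) v0) - card (insert w (Q \<inter> N (\<sigma> r) v0))"
    unfolding M_def using w Q(3) by (intro card_Diff_subset) auto
  ultimately have M: "card Lr \<le> card M" using v0 card_r by linarith
  have MN: "M \<subseteq> N (\<sigma> r) v0" by (auto simp: M_def)
  obtain f where f: "emb N \<sigma> E f (insert r Lr)" "f r = v0" "f ` Lr \<subseteq> M"
    using emb_star[of Lr E r \<sigma> M v0, OF fin(2) leaf(2) notin(4) E_irrefl E_sym \<sigma> MN M] by blast
  have "\<exists>g. emb N \<sigma> E g (insert r Lr \<union> {x} \<union> Lx)"
  proof (rule emb_extend_star[OF f(1), where p = r and w = w and M = Q])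
    show "w \<notin> f ` insert r Lr" using f \<open>w \<noteq> v0\<close> by (auto simp: M_def)
    show "Q \<inter> f ` insert r Lr = {}" using f Q(1) by (auto simp: M_def)
    show "insert r Lr \<inter> Lx = {}" using disj notin by auto
  qed (use xr notin fin leaf E_sym \<sigma> w f Q in \<open>auto simp: Lx_def\<close>)
  then show ?thesis using V_eq by simp
qed

text \<open>The middle vertex goes to \<open>v0\<close>, and two of its neighbours are each
  continued by a further neighbour. The third neighbour of \<open>v0\<close> is a reserve in case a
  continuation runs into the other neighbour.\<close>

lemma emb_path5:
  assumes dist: "distinct [a, b, c, d, e]"
    and edges: "\<And>u v. (u, v) \<in> E \<Longrightarrow> {u, v} \<in> {{a, b}, {b, c}, {c, d}, {d, e}}"
    and \<sigma>: "\<sigma> a \<noteq> \<sigma> b" "\<sigma> b \<noteq> \<sigma> c" "\<sigma> c \<noteq> \<sigma> d" "\<sigma> d \<noteq> \<sigma> e"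
    and deg: "\<And>s w. N s w \<noteq> {} \<Longrightarrow> 2 \<le> card (N s w)"
    and v0: "3 \<le> card (N (\<sigma> c) v0)"
  shows "\<exists>f. emb N \<sigma> E f {a, b, c, d, e}"
proof -
  obtain Y where "Y \<subseteq> N (\<sigma> c) v0" "card Y = 3" using v0 by (meson obtain_subset_with_card_n)
  then obtain u1 u2 u3 where u: "u1 \<in> N (\<sigma> c) v0" "u2 \<in> N (\<sigma> c) v0" "u3 \<in> N (\<sigma> c) v0"
    "u1 \<noteq> u2" "u1 \<noteq> u3" "u2 \<noteq> u3"
    by (auto simp: card_3_iff)
  have ex_w: "\<exists>w. w \<in> N (\<not> \<sigma> c) v \<and> w \<noteq> v0" if "v \<in> N (\<sigma> c) v0" for v
  proof -
    have "v0 \<in> N (\<not> \<sigma> c) v" using that N_sym by blast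
    then have "2 \<le> card (N (\<not> \<sigma> c) v)" using deg by blast
    then have "\<not> N (\<not> \<sigma> c) v \<subseteq> {v0}" using card_mono[of "{v0}" "N (\<not> \<sigma> c) v"] by auto
    then show ?thesis by blast
  qed
  define W where "W v = (SOME w. w \<in> N (\<not> \<sigma> c) v \<and> w \<noteq> v0)" for v
  have W: "W v \<in> N (\<not> \<sigma> c) v" "W v \<noteq> v0" "v \<in> N (\<sigma> c) (W v)" if "v \<in> N (\<sigma> c) v0" for v
    using someI_ex[OF ex_w[OF that]] N_sym[of "W v" "\<not> \<sigma> c" v] unfolding W_def by auto
  \<comment> \<open>If no pair worked, \<open>u1\<close> would be joined to both \<open>u2\<close>
    and \<open>u3\<close>, a common neighbour of them besides \<open>v0\<close>.\<close>
  have ok: "\<exists>i j. i \<in> N (\<sigma> c) v0 \<and> j \<in> N (\<sigma> c) v0 \<and> i \<noteq> j \<and> W i \<noteq> j \<and> W j \<noteq> i"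
  proof (rule ccontr)
    assume "\<not> ?thesis"
    then have "W u1 = u2 \<or> W u2 = u1" "W u1 = u3 \<or> W u3 = u1" using u by blast+
    then have "(\<exists>s. u1 \<in> N s u2) \<and> (\<exists>s. u1 \<in> N s u3)" using W u by metis
    moreover have "u1 \<noteq> v0" using u N_irrefl by blast
    ultimately show False using no_4cycle u by blast
  qed
  then obtain i j where ij: "i \<in> N (\<sigma> c) v0" "j \<in> N (\<sigma> c) v0" "i \<noteq> j" "W i \<noteq> j" "W j \<noteq> i" by blast
  note Wi = W[OF ij(1)] and Wj = W[OF ij(2)]
  have "W i \<noteq> W j"
    using no_4cycle[OF ij(1-3), of "W i"] Wi Wj by metis
  moreover have "W i \<noteq> i" "W j \<noteq> j" "v0 \<noteq> i" "v0 \<noteq> j"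
    using Wi Wj ij N_irrefl by metis+
  ultimately have dist': "distinct [W i, i, v0, j, W j]" using Wi Wj ij by auto
  define f where "f v = (if v = a then W i else if v = b then i else if v = c then v0
    else if v = d then j else W j)" for v
  have f: "f a = W i" "f b = i" "f c = v0" "f d = j" "f e = W j"
    using dist by (auto simp: f_def)
  have s: "\<sigma> a = \<sigma> c" "\<sigma> b = (\<not> \<sigma> c)" "\<sigma> d = (\<not> \<sigma> c)" "\<sigma> e = \<sigma> c" using \<sigma> by auto
  have v0_nbr: "v0 \<in> N (\<not> \<sigma> c) i" "v0 \<in> N (\<not> \<sigma> c) j" using ij N_sym by blast+
  have "inj_on f {a, b, c, d, e}" using dist' f by auto
  moreover have "f v \<in> N (\<sigma> u) (f u)" if "(u, v) \<in> E" for u v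
    using edges[OF that] f s v0_nbr Wi Wj ij by (auto simp: doubleton_eq_iff)
  ultimately show ?thesis by (auto simp: emb_def)
qed

text \<open>\<open>\<Delta>\<close> is merely an upper bound on the degrees, so it stays fixed while
  leaves are deleted and \<open>big\<close> survives the induction. Which direction of
  \<open>big\<close> is used depends on the tree vertex that is put on \<open>v0\<close>.\<close>

theorem emb_tree:
  assumes "utree V E" "2 \<le> card V" "\<And>u v. (u, v) \<in> E \<Longrightarrow> \<sigma> u \<noteq> \<sigma> v"
    and "\<And>s w. N s w \<noteq> {} \<Longrightarrow> card V \<le> 2 * card (N s w) + 1"
    and "\<And>v. v \<in> V \<Longrightarrow> card (E `` {v}) \<le> \<Delta>"
    and big: "\<And>s. \<exists>v. \<Delta> < card (N s v)"
  shows "\<exists>f. emb N \<sigma> E f V"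
  using assms(1-5)
proof (induction "card V" arbitrary: V E rule: less_induct)
  case less
  interpret utree V E by (fact less.prems(1))
  note \<sigma> = less.prems(3) and deg = less.prems(4) and \<Delta> = less.prems(5)
  have in_V: "u \<in> V" "v \<in> V" if "(u, v) \<in> E" for u v using that EV by auto
  have fin_nbr: "finite (E `` {v})" for v
  proof -
    have "E `` {v} \<subseteq> V" using in_V by blast
    then show ?thesis using finV finite_subset by blast
  qed
  have main: "\<exists>f. emb N \<sigma> E f V"
    if xt: "x \<noteq> t" and pen: "penultimate E x p" "penultimate E t p'"
      and le: "card (E `` {x} - {p}) \<le> card (E `` {t} - {p'})" for x p t p'
  proof (cases "t = p")
    case True
    obtain y where y: "(x, y) \<in> E" "y \<noteq> p" using pen(1) by (auto simp: penultimate_def)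
    have "(t, x) \<in> E" using pen(1) E_sym True by (auto simp: penultimate_def)
    \<comment> \<open>\<open>x\<close> is a neighbour of \<open>t\<close> but no leaf, so it can
      only be the inner neighbour of \<open>t\<close>.\<close>
    then have "p' = x" using pen(2) y True by (auto simp: penultimate_def leaf_at_def)
    obtain v0 where v0: "\<Delta> < card (N (\<sigma> t) v0)" using big by blast
    then have "card (E `` {t}) < card (N (\<sigma> t) v0)" using \<Delta>[of t] in_V \<open>(t, x) \<in> E\<close> by fastforce
    then show ?thesis
      using emb_double_star[of V E \<sigma> x t v0, OF less.prems(1) \<sigma> deg] pen le True
        \<open>p' = x\<close> by blast
  next
    case False
    obtain y0 where y0: "(x, y0) \<in> E" "y0 \<noteq> p" and xp: "(x, p) \<in> E"
      using pen(1) by (auto simp: penultimate_def)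
    have leaf: "leaf_at E x y0" using pen(1) y0 by (auto simp: penultimate_def)
    define V' where "V' = V - {y0}"
    define E' where "E' = E \<inter> V' \<times> V'"
    have y0V: "y0 \<in> V" using in_V y0 by blast
    have less': "card V' < card V" unfolding V'_def using finV y0V by (rule card_Diff1_less)
    have "\<exists>f. emb N \<sigma> E' f V'"
    proof (rule less.hyps[OF less'])
      show "utree V' E'" unfolding E'_def by (rule delete_leaf[OF y0V leaf V'_def])
      have "{x, p} \<subseteq> V'" using in_V xp y0 E_irrefl by (auto simp: V'_def)
      moreover have "x \<noteq> p" using xp E_irrefl by auto
      ultimately show "2 \<le> card V'" using card_mono[of V' "{x, p}"] finV by (auto simp: V'_def)
      show "\<sigma> u \<noteq> \<sigma> v" if "(u, v) \<in> E'" for u v using \<sigma> that by (auto simp: E'_def)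
      show "card V' \<le> 2 * card (N s w) + 1" if "N s w \<noteq> {}" for s w using deg[OF that] less' by simp
      show "card (E' `` {v}) \<le> \<Delta>" if "v \<in> V'" for v
      proof -
        have "card (E' `` {v}) \<le> card (E `` {v})" using fin_nbr by (intro card_mono) (auto simp: E'_def)
        then show ?thesis using \<Delta>[of v] that by (simp add: V'_def)
      qed
    qed
    then obtain f where f: "emb N \<sigma> E f (V - {y0})" by (auto simp: emb_def E'_def V'_def)
    show ?thesis
    proof (rule ccontr)
      assume no: "\<not> ?thesis"
      have t: "t \<in> V" using pen(2) in_V by (auto simp: penultimate_def)
      interpret near_embedding N V E \<sigma> f x p y0 t "E `` {t} - {p'}"
        using finV EV E_sym \<sigma> conn pen y0 t xt False le f no deg
        by unfold_locales (auto simp: penultimate_def)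
      obtain l where l: "V = {y0, x, p, t, l}" "distinct [y0, x, p, t, l]" "(p, t) \<in> E" "(t, l) \<in> E"
        "\<And>u v. (u, v) \<in> E \<Longrightarrow> {u, v} \<in> {{y0, x}, {x, p}, {p, t}, {t, l}}"
        by (rule path_case) blast
      obtain v0 where v0: "\<Delta> < card (N (\<sigma> p) v0)" using big by blast
      \<comment> \<open>\<open>p\<close> has two neighbours, so \<open>v0\<close> has the three that
        \<open>emb_path5\<close> asks for.\<close>
      have "{x, t} \<subseteq> E `` {p}" using E_sym xp l by auto
      then have "card {x, t} \<le> card (E `` {p})" using fin_nbr card_mono by blast
      then have "3 \<le> card (N (\<sigma> p) v0)" using xt v0 \<Delta>[of p] in_V xp by fastforce
      moreover have "2 \<le> card (N s w)" if "N s w \<noteq> {}" for s w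
      proof -
        have "card V = 5" using distinct_card[OF l(2)] l(1) by simp
        then show ?thesis using deg[OF that] by simp
      qed
      ultimately have "\<exists>g. emb N \<sigma> E g {y0, x, p, t, l}"
        using emb_path5[of y0 x p t l E \<sigma> v0, OF l(2) l(5)] \<sigma> E_sym y0(1) xp l(3,4) by blast
      then show False using no l(1) by simp
    qed
  qed
  show ?case
  proof (rule star_or_penultimates[OF less.prems(2)])
    fix c assume c: "c \<in> V" "\<And>u. (c, u) \<in> E \<Longrightarrow> leaf_at E c u"
    have V_eq: "V = insert c (E `` {c})"
    proof (rule ccontr)
      assume "V \<noteq> insert c (E `` {c})"
      moreover have "insert c (E `` {c}) \<subseteq> V" using in_V c(1) by auto
      ultimately obtain u v where "u \<in> insert c (E `` {c})" "v \<notin> insert c (E `` {c})" "(u, v) \<in> E"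
        by (metis cut_connectedE[OF conn] insert_not_empty)
      then show False using c(2) by (auto simp: leaf_at_def)
    qed
    obtain v0 where v0: "\<Delta> < card (N (\<sigma> c) v0)" using big by blast
    then have le: "card (E `` {c}) \<le> card (N (\<sigma> c) v0)" using \<Delta>[OF c(1)] by simp
    have leaf: "leaf_at E c l" if "l \<in> E `` {c}" for l using c(2) that by simp
    have "c \<notin> E `` {c}" using E_irrefl by simp
    note emb_star = emb_star[of "E `` {c}" E c \<sigma> "N (\<sigma> c) v0" v0,
        OF fin_nbr leaf this E_irrefl E_sym \<sigma> subset_refl le]
    obtain f where "emb N \<sigma> E f (insert c (E `` {c}))" by (rule emb_star) blast
    then show ?thesis using V_eq by metis
  next
    fix x p t p' assume "x \<noteq> t" "penultimate E x p" "penultimate E t p'"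
    then show ?thesis using main[of x t p p'] main[of t x p' p] nat_le_linear by metis
  qed
qed

end

section \<open>Translation to digraphs\<close>

lemma parcs_sym_iff:
  "(u, v) \<in> parcs (mk_symmetric (with_proj T)) \<longleftrightarrow> (u, v) \<in> parcs T \<or> (v, u) \<in> parcs T"
  by (auto simp: parcs_mk_symmetric intro: bexI[of _ "(u, v)"] bexI[of _ "(v, u)"])

text \<open>Turns cycles given as vertex lists into the arc lists used by the library predicate
  \<open>cycle\<close>.\<close>

lemma pcas_zip: "pcas u (zip (u # c) (c @ [v])) v"
  by (induction c arbitrary: u) auto

lemma pawalk_verts_zip: "pawalk_verts u (zip (u # c) (c @ [v])) = u # c @ [v]"
  by (induction c arbitrary: u) auto

lemma set_zip_successively:
  "successively (\<lambda>u v. (u, v) \<in> E) (u # c) \<Longrightarrow> (last (u # c), v) \<in> E \<Longrightarrow> set (zip (u # c) (c @ [v])) \<subseteq> E"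
  by (induction c arbitrary: u) auto

lemma utree_oriented_tree:
  assumes "oriented_tree T"
  shows "utree (pverts T) (parcs (mk_symmetric (with_proj T)))"
    (is "utree ?V ?E")
proof
  interpret pair_digraph T using assms by (simp add: oriented_tree_def)
  show "finite ?V" by (rule pair_finite_verts)
  show E_V: "?E \<subseteq> ?V \<times> ?V" using in_arcsD1 in_arcsD2 by (auto simp: parcs_sym_iff)
  show "(v, u) \<in> ?E" if "(u, v) \<in> ?E" for u v using that by (auto simp: parcs_sym_iff)
  show "(u, u) \<notin> ?E" for u using no_loops' by (auto simp: parcs_sym_iff)
  show "cut_connected ?V ?E"
    unfolding cut_connected_def
  proof (intro allI impI)
    fix W assume W: "W \<subseteq> ?V" "W \<noteq> {}" "W \<noteq> ?V"
    then obtain a b where ab: "a \<in> W" "b \<in> ?V" "b \<notin> W" by blast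
    have "strongly_connected (with_proj (mk_symmetric (with_proj T)))"
      using assms by (simp add: oriented_tree_def connected_def)
    then have "(a, b) \<in> rtrancl_on ?V ?E"
      using ab W by (auto simp: strongly_connected_def reachable_def)
    \<comment> \<open>If no edge left \<open>W\<close>, a walk starting in \<open>a\<close> could
      never get out of it.\<close>
    moreover have "b \<in> W" if "(a, b) \<in> rtrancl_on ?V ?E" "\<forall>u\<in>W. \<forall>v\<in>?V - W. (u, v) \<notin> ?E"
      using that(1) by (induction rule: rtrancl_on_induct) (use ab that(2) in blast)+
    ultimately show "\<exists>u\<in>W. \<exists>v\<in>?V - W. (u, v) \<in> ?E" using ab by blast
  qed
  show "no_cycle ?E"
    unfolding no_cycle_def
  proof
    assume "\<exists>c. 3 \<le> length c \<and> distinct c \<and> successively (\<lambda>u v. (u, v) \<in> ?E) c \<and> (last c, hd c) \<in> ?E"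
    then obtain c where c: "3 \<le> length c" "distinct c" "successively (\<lambda>u v. (u, v) \<in> ?E) c"
      "(last c, hd c) \<in> ?E" by blast
    then obtain u c' where cu: "c = u # c'" by (cases c) auto
    let ?p = "zip (u # c') (c' @ [u])"
    have "set ?p \<subseteq> ?E" using set_zip_successively[of ?E u c' u] c cu by simp
    moreover have "u \<in> ?V" using c(4) cu E_V by auto
    moreover have "3 \<le> length ?p" "?p \<noteq> []" using c(1) cu by auto
    ultimately have "3 \<le> length ?p \<and> pre_digraph.cycle (with_proj (mk_symmetric (with_proj T))) ?p"
      using c(2) cu pcas_zip[of u c' u] pawalk_verts_zip[of u c' u]
      unfolding pre_digraph.cycle_def pre_digraph.awalk_def cas_with_proj_eq awalk_verts_with_proj_eq
      by (intro conjI exI[of _ u]) auto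
    then show False using assms unfolding oriented_tree_def by blast
  qed
qed

text \<open>Grow a vertex set along cut edges: each new vertex brings an arc not contained in the
  old set. For the tree this gives at most \<open>k + 1\<close> vertices.\<close>

lemma cut_connected_card_le:
  assumes conn: "cut_connected V E" and fin: "finite V" "V \<noteq> {}" "finite A"
    and E: "\<And>u v. (u, v) \<in> E \<Longrightarrow> (u, v) \<in> A \<or> (v, u) \<in> A"
  shows "card V \<le> card A + 1"
proof -
  have "\<exists>W\<subseteq>V. card W = Suc n \<and> n \<le> card (A \<inter> W \<times> W)" if "Suc n \<le> card V" for n
    using that
  proof (induction n)
    case 0
    obtain v where "v \<in> V" using fin by blast
    then show ?case by (intro exI[of _ "{v}"]) auto
  next
    case (Suc n)
    then obtain W where W: "W \<subseteq> V" "card W = Suc n" "n \<le> card (A \<inter> W \<times> W)" by auto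
    then have "W \<noteq> {}" "W \<noteq> V" using Suc.prems by auto
    then obtain u v where uv: "u \<in> W" "v \<in> V" "v \<notin> W" "(u, v) \<in> E"
      using conn W(1) by (blast elim: cut_connectedE)
    define e where "e = (if (u, v) \<in> A then (u, v) else (v, u))"
    have e: "e \<in> A" "e \<notin> W \<times> W" "e \<in> insert v W \<times> insert v W"
      using E[OF uv(4)] uv by (auto simp: e_def)
    have "finite W" using W(1) fin(1) finite_subset by blast
    have "insert e (A \<inter> W \<times> W) \<subseteq> A \<inter> insert v W \<times> insert v W" using e by auto
    then have "card (insert e (A \<inter> W \<times> W)) \<le> card (A \<inter> insert v W \<times> insert v W)"
      using fin(3) by (intro card_mono) auto
    moreover have "card (insert e (A \<inter> W \<times> W)) = Suc (card (A \<inter> W \<times> W))"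
      using e fin(3) by simp
    ultimately have "Suc n \<le> card (A \<inter> insert v W \<times> insert v W)" using W(3) by simp
    moreover have "card (insert v W) = Suc (Suc n)" using uv(3) \<open>finite W\<close> W(2) by simp
    ultimately show ?case using W(1) uv(2) by (intro exI[of _ "insert v W"]) auto
  qed
  moreover have "card V \<noteq> 0" using fin by simp
  ultimately obtain W where "card V - 1 \<le> card (A \<inter> W \<times> W)" by (metis Suc_pred' le_refl neq0_conv)
  also have "\<dots> \<le> card A" using fin(3) by (intro card_mono) auto
  finally show ?thesis by simp
qed

section \<open>Neighbourhoods, degrees and 4-cycles of a digraph\<close>

definition arc_nbrs :: "'a pair_pre_digraph \<Rightarrow> bool \<Rightarrow> 'a \<Rightarrow> 'a set" where
  "arc_nbrs G s v = (if s then {w. (v, w) \<in> parcs G} else {w. (w, v) \<in> parcs G})"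

lemma card_arc_nbrs:
  "card (arc_nbrs G True v) = out_degree (with_proj G) v"
  "card (arc_nbrs G False v) = in_degree (with_proj G) v"
proof -
  have "bij_betw (\<lambda>w. (v, w)) (arc_nbrs G True v) (out_arcs (with_proj G) v)"
    by (rule bij_betwI[where g = snd]) (auto simp: arc_nbrs_def out_arcs_def)
  then show "card (arc_nbrs G True v) = out_degree (with_proj G) v"
    by (simp add: out_degree_def bij_betw_same_card)
  have "bij_betw (\<lambda>w. (w, v)) (arc_nbrs G False v) (in_arcs (with_proj G) v)"
    by (rule bij_betwI[where g = fst]) (auto simp: arc_nbrs_def in_arcs_def)
  then show "card (arc_nbrs G False v) = in_degree (with_proj G) v"
    by (simp add: in_degree_def bij_betw_same_card)
qed

lemma degree_le_card_parcs:
  assumes "finite (parcs G)"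
  shows "out_degree (with_proj G) v \<le> card (parcs G)" "in_degree (with_proj G) v \<le> card (parcs G)"
  using assms by (auto simp: out_degree_def in_degree_def out_arcs_def in_arcs_def intro: card_mono)

text \<open>\<open>GREATEST\<close> is meaningful only for a bounded nonempty range: the given
  neighbourhood bounds every admissible value, and \<open>0\<close> is admissible.\<close>

lemma min_pseudo_semidegree_le:
  assumes "pair_digraph G" "arc_nbrs G s v \<noteq> {}"
  shows "min_pseudo_semidegree G \<le> card (arc_nbrs G s v)"
proof -
  interpret pair_digraph G by fact
  define P where "P d \<longleftrightarrow> \<not> (\<exists>v \<in> pverts G.
      (0 < in_degree (with_proj G) v \<and> in_degree (with_proj G) v < d) \<or>
      (0 < out_degree (with_proj G) v \<and> out_degree (with_proj G) v < d))" for d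
  have arcs: "parcs G \<noteq> {}" using assms(2) by (auto simp: arc_nbrs_def split: if_splits)
  have v: "v \<in> pverts G"
    using assms(2) in_arcsD1 in_arcsD2 by (auto simp: arc_nbrs_def split: if_splits)
  have sub: "arc_nbrs G s v \<subseteq> pverts G" for s v
    using in_arcsD1 in_arcsD2 by (auto simp: arc_nbrs_def)
  then have pos: "0 < card (arc_nbrs G s v)"
    using assms(2) pair_finite_verts finite_subset by (metis card_gt_0_iff)
  have le: "d \<le> card (arc_nbrs G s v)" if "P d" for d
    using that v pos unfolding P_def by (cases s) (auto simp: card_arc_nbrs not_less)
  then have "P (GREATEST d. P d)"
    by (intro GreatestI_nat[of P 0]) (auto simp: P_def)
  then show ?thesis
    using le arcs unfolding min_pseudo_semidegree_def P_def by simp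
qed

lemma max_semidegree_le:
  assumes "pair_digraph G" "pverts G \<noteq> {}"
  shows "\<exists>v. max_semidegree G \<le> card (arc_nbrs G s v)"
proof -
  interpret pair_digraph G by fact
  define P where "P m \<longleftrightarrow> (\<exists>u \<in> pverts G. m \<le> out_degree (with_proj G) u) \<and>
    (\<exists>v \<in> pverts G. m \<le> in_degree (with_proj G) v)" for m
  have "P 0" using assms(2) by (auto simp: P_def)
  moreover have "m \<le> card (parcs G)" if "P m" for m
    using that degree_le_card_parcs[OF pair_finite_arcs] unfolding P_def by (meson order_trans)
  ultimately have "P (GREATEST m. P m)" by (rule GreatestI_nat) blast
  then have "P (max_semidegree G)" unfolding max_semidegree_def P_def .
  then show ?thesis unfolding P_def by (cases s) (auto simp: card_arc_nbrs)
qed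

lemma c4_host_arc_nbrs:
  assumes "pair_digraph D"
    and cyc: "\<And>C. subgraph (with_proj C) (with_proj D) \<Longrightarrow> oriented_4cycle C \<Longrightarrow> directed_4cycle C"
  shows "c4_host (arc_nbrs D)"
proof
  interpret pair_digraph D by fact
  show "w \<in> arc_nbrs D s v \<longleftrightarrow> v \<in> arc_nbrs D (\<not> s) w" for w s v by (simp add: arc_nbrs_def)
  show irr: "v \<notin> arc_nbrs D s v" for s v using no_loops' by (auto simp: arc_nbrs_def)
  have sub: "arc_nbrs D s v \<subseteq> pverts D" for s v
    using in_arcsD1 in_arcsD2 by (auto simp: arc_nbrs_def)
  then show "finite (arc_nbrs D s v)" for s v
    using pair_finite_verts finite_subset by blast
  fix v v' u w s s1 s2
  assume H: "v \<in> arc_nbrs D s u" "v' \<in> arc_nbrs D s u" "v \<noteq> v'" "w \<noteq> u"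
    "w \<in> arc_nbrs D s1 v" "w \<in> arc_nbrs D s2 v'"
  define arc where "arc r x y = (if r then (x, y) else (y, x))" for r and x y :: 'a
  have arcD: "arc r x y \<in> parcs D" if "y \<in> arc_nbrs D r x" for r x y
    using that by (auto simp: arc_def arc_nbrs_def split: if_splits)
  define C where "C = \<lparr>pverts = {u, v, w, v'}, parcs = {arc s u v, arc s1 v w, arc s2 v' w, arc s u v'}\<rparr>"
  have dist: "distinct [u, v, w, v']" using H irr by auto
  have arcs: "parcs C \<subseteq> parcs D" using H arcD by (auto simp: C_def)
  have "pverts C \<subseteq> pverts D"
    using H arcs in_arcsD1 in_arcsD2 by (auto simp: C_def arc_def split: if_splits)
  moreover have "pair_wf_digraph C"
    by unfold_locales (auto simp: C_def arc_def)
  ultimately have "subgraph (with_proj C) (with_proj D)"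
    using arcs wf_digraph_wp_iff wf_digraph by (auto simp: subgraph_def compatible_def)
  moreover have "arc s u v \<in> {(u, v), (v, u)}" "arc s1 v w \<in> {(v, w), (w, v)}"
    "arc s2 v' w \<in> {(w, v'), (v', w)}" "arc s u v' \<in> {(v', u), (u, v')}"
    by (simp_all add: arc_def)
  then have "oriented_4cycle C"
    unfolding oriented_4cycle_def using dist C_def by blast
  ultimately have "directed_4cycle C" by (rule cyc)
  then obtain a b c d where abcd: "distinct [a, b, c, d]"
    "parcs C = {(a, b), (b, c), (c, d), (d, a)}"
    by (auto simp: directed_4cycle_def)
  \<comment> \<open>Distinct arcs of a directed 4-cycle differ in tail and in head, whereas these
    two have \<open>u\<close> on the same side.\<close>
  have "arc s u v \<in> {(a, b), (b, c), (c, d), (d, a)}" "arc s u v' \<in> {(a, b), (b, c), (c, d), (d, a)}"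
    unfolding abcd(2)[symmetric] by (simp_all add: C_def)
  then show False using abcd(1) H(3) by (auto simp: arc_def split: if_splits)
qed

theorem theorem3:
  fixes k :: nat
    and T :: "'b pair_pre_digraph"
    and D :: "'a pair_pre_digraph"
  assumes "k \<ge> 1"
    and "antidirected_tree T"
    and "card (parcs T) = k"
    and "pair_digraph D"
    and "real (min_pseudo_semidegree D) \<ge> real k / 2"
    and "\<And>C. subgraph (with_proj C) (with_proj D) \<Longrightarrow> oriented_4cycle C \<Longrightarrow> directed_4cycle C"
    and "max_semidegree D > max_total_degree T"
  shows "contains_digraph D T"
proof -
  define E where "E = parcs (mk_symmetric (with_proj T))"
  have tree: "oriented_tree T" and anti: "antidirected T"
    using assms(2) by (auto simp: antidirected_tree_def)
  have E_iff: "(u, v) \<in> E \<longleftrightarrow> (u, v) \<in> parcs T \<or> (v, u) \<in> parcs T" for u v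
    unfolding E_def by (rule parcs_sym_iff)
  interpret T: pair_digraph T using tree by (simp add: oriented_tree_def)
  interpret D: pair_digraph D by fact
  interpret T: utree "pverts T" E unfolding E_def by (rule utree_oriented_tree[OF tree])
  interpret c4_host "arc_nbrs D" by (rule c4_host_arc_nbrs) (use assms in blast)+
  have "parcs T \<noteq> {}" using assms(1,3) by auto
  then obtain u0 v0 where e0: "(u0, v0) \<in> parcs T" by auto
  have card2: "2 \<le> card (pverts T)"
  proof -
    have "{u0, v0} \<subseteq> pverts T" "u0 \<noteq> v0" using e0 T.in_arcsD1 T.in_arcsD2 T.no_loops' by auto
    then show ?thesis using card_mono[OF T.finV, of "{u0, v0}"] by simp
  qed
  have "card (pverts T) \<le> k + 1"
    using cut_connected_card_le[OF T.conn T.finV _ T.pair_finite_arcs] E_iff card2 assms(3) by fastforce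
  moreover have "k \<le> 2 * min_pseudo_semidegree D" using assms(5) by linarith
  ultimately have host_deg: "card (pverts T) \<le> 2 * card (arc_nbrs D s w) + 1"
    if "arc_nbrs D s w \<noteq> {}" for s w
    using min_pseudo_semidegree_le[OF assms(4) that] by linarith
  define \<sigma> where "\<sigma> v \<longleftrightarrow> (\<exists>w. (v, w) \<in> parcs T)" for v
  have \<sigma>_arc: "\<sigma> u \<and> \<not> \<sigma> v" if uv: "(u, v) \<in> parcs T" for u v
  proof -
    have "(u, v) \<in> in_arcs (with_proj T) v" using uv by (simp add: in_arcs_def)
    then have "in_degree (with_proj T) v \<noteq> 0"
      using T.finite_in_arcs[of v] unfolding in_degree_def by (metis card_eq_0_iff empty_iff)
    then have "out_degree (with_proj T) v = 0"
      using anti T.in_arcsD2[OF uv] by (auto simp: antidirected_def)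
    then have "out_arcs (with_proj T) v = {}"
      using T.finite_out_arcs[of v] unfolding out_degree_def by simp
    then show ?thesis using uv by (auto simp: \<sigma>_def out_arcs_def)
  qed
  have deg_T: "card (E `` {v}) \<le> max_total_degree T" if "v \<in> pverts T" for v
  proof -
    have "E `` {v} = arc_nbrs (mk_symmetric (with_proj T)) True v" by (auto simp: E_def arc_nbrs_def)
    then have "card (E `` {v}) = out_degree (with_proj (mk_symmetric (with_proj T))) v"
      by (simp add: card_arc_nbrs)
    also have "\<dots> \<le> max_total_degree T"
      unfolding max_total_degree_def using that T.finV by (intro Max_ge) auto
    finally show ?thesis .
  qed
  \<comment> \<open>An arcless \<open>D\<close> would have pseudo-semidegree \<open>0\<close>,
    against \<open>k \<ge> 1\<close>.\<close>
  have "parcs D \<noteq> {}"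
    using \<open>k \<le> 2 * min_pseudo_semidegree D\<close> assms(1) by (auto simp: min_pseudo_semidegree_def)
  then have "pverts D \<noteq> {}" using D.in_arcsD1 by fastforce
  then have big: "\<exists>v. max_total_degree T < card (arc_nbrs D s v)" for s
    using max_semidegree_le[OF assms(4), of s] assms(7) by (meson less_le_trans)
  obtain f where f: "emb (arc_nbrs D) \<sigma> E f (pverts T)"
    using emb_tree[OF T.utree_axioms card2 _ host_deg deg_T big, of \<sigma>] E_iff \<sigma>_arc by blast
  have arc: "(f u, f v) \<in> parcs D" if uv: "(u, v) \<in> parcs T" for u v
  proof -
    have "f v \<in> arc_nbrs D (\<sigma> u) (f u)"
      using f uv E_iff T.in_arcsD1 T.in_arcsD2 unfolding emb_def by blast
    then show ?thesis using \<sigma>_arc[OF uv] by (simp add: arc_nbrs_def)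
  qed
  \<comment> \<open>\<open>emb\<close> does not mention the vertices of \<open>D\<close>; but every
    tree vertex is on an arc, whose image is an arc of \<open>D\<close>.\<close>
  have "f ` pverts T \<subseteq> pverts D"
  proof
    fix y assume "y \<in> f ` pverts T"
    then obtain v where v: "v \<in> pverts T" "y = f v" by blast
    have "card {v} \<noteq> card (pverts T)" using card2 by simp
    then have "{v} \<noteq> pverts T" by metis
    then obtain w where "(v, w) \<in> E" using T.conn v by (blast elim: cut_connectedE[where W = "{v}"])
    then show "y \<in> pverts D" using E_iff arc v(2) D.in_arcsD1 D.in_arcsD2 by blast
  qed
  then show ?thesis
    using f arc unfolding contains_digraph_def emb_def by blast
qed

end
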